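(* Suppose that two-sided subshifts $\Lambda_1$ and $\Lambda_2$ are topologically conjugate via a homeomorphism $h_\Lambda:\Lambda_1\to\Lambda_2$. Then there exists a homeomorphism $h:\mathcal{X}_{\Lambda_1}\to\mathcal{X}_{\Lambda_2}$ satisfying the following conditions: (i) $h_\Lambda\circ\pi_1=\pi_2\circ h$, where $\pi_i:\mathcal{X}_{\Lambda_i}\to\Lambda_i$, $i=1,2$, is the factor map; (ii) $h\circ\sigma_{\mathcal{X}_{\Lambda_1}}=\sigma_{\mathcal{X}_{\Lambda_2}}\circ h$; (iii) $(h\times h)(R_{\Lambda_1})=R_{\Lambda_2}$; (iv) the map $h\times h:R_{\Lambda_1}\to R_{\Lambda_2}$ is a homeomorphism with respect to the topologies of the étale equivalence relations $R_{\Lambda_1}$ and $R_{\Lambda_2}$.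
   Context: **$\lambda$-graph bisystem.** Let $\Sigma$ be a finite set. A $\lambda$-graph bisystem $\mathcal{L}=(\mathcal{L}^-,\mathcal{L}^+)$ over $\Sigma$ consists of two labeled Bratteli diagrams $\mathcal{L}^{-}=(V,E^{-},\lambda^{-})$, $\mathcal{L}^{+}=(V,E^{+},\lambda^{+})$ with common vertex set $V=\bigcup_{l\ge 0}V_l$ and edge sets $E^-=\bigcup_{l\ge0}E^-_{l+1,l}$, $E^+=\bigcup_{l\ge0}E^+_{l,l+1}$ (all $V_l$, $E^-_{l+1,l}$, $E^+_{l,l+1}$ are finite, nonempty and pairwise disjoint, and $V_0$ is a singleton). An edge $e^-\in E^-_{l+1,l}$ has source $s(e^-)\in V_{l+1}$ and terminal $t(e^-)\in V_l$; an edge $e^+\in E^+_{l,l+1}$ has source $s(e^+)\in V_l$ and terminal $t(e^+)\in V_{l+1}$; labels are given by $\lambda^\pm:E^\pm\to\Sigma$. Required: (1) $\mathcal{L}^-$ is right-resolving: distinct $e^-,f^-\in E^-_{l+1,l}$ with $s(e^-)=s(f^-)$ have $\lambda^-(e^-)\neq\lambda^-(f^-)$; (2) $\mathcal{L}^+$ is left-resolving: distinct $e^+,f^+\in E^+_{l,l+1}$ with $t(e^+)=t(f^+)$ have $\lambda^+(e^+)\ne\lambda^+(f^+)$; (3) local property: for all $u\in V_l$, $v\in V_{l+2}$ there is a bijection $\phi$ from $\{(f^+,f^-)\in E^+_{l,l+1}\times E^-_{l+2,l+1}: s(f^+)=u,\ t(f^+)=t(f^-),\ s(f^-)=v\}$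 onto $\{(e^-,e^+)\in E^-_{l+1,l}\times E^+_{l+1,l+2}: t(e^-)=u,\ s(e^-)=s(e^+),\ t(e^+)=v\}$ such that $\phi(f^+,f^-)=(e^-,e^+)$ implies $\lambda^+(f^+)=\lambda^+(e^+)$ and $\lambda^-(f^-)=\lambda^-(e^-)$. For $v\in V_l$, let $F(v)\subset\Sigma^l$ be the set of words $(\lambda^-(e^-_l),\dots,\lambda^-(e^-_1))$ with $e^-_n\in E^-_{n,n-1}$, $s(e^-_l)=v$, $t(e_n^-)=s(e_{n-1}^-)$, and let $P(v)\subset\Sigma^l$ be the set of words $(\lambda^+(e^+_1),\dots,\lambda^+(e^+_l))$ with $e^+_n\in E^+_{n-1,n}$, $t(e^+_l)=v$, $s(e^+_n)=t(e^+_{n-1})$. FPCC means $F(v)=P(v)$ for all $v\in V$. **Configuration space.** Let $\mathbb{Z}^2[<]=\{(k,l)\in\mathbb{Z}^2: k<l\}$, $n(k,l)=l-k-1$, $V_{(k,l)}=V_{n(k,l)}$, $E^-_{(k-1,k),l}=E^-_{n(k-1,l),n(k,l)}$, $E^+_{k,(l,l+1)}=E^+_{n(k,l),n(k,l+1)}$. $\mathcal{X}_{\mathcal{L}}$ is the set of configurations $x=\{(v_{(k,l)},e^-_{(k-1,k),l},e^+_{k,(l,l+1)})\}_{(k,l)\in\mathbb{Z}^2[<]}$ with $v_{(k,l)}\in V_{(k,l)}$, $e^-_{(k-1,k),l}\in E^-_{(k-1,k),l}$, $e^+_{k,(l,l+1)}\in E^+_{k,(l,l+1)}$, such that $s(e^-_{(k-1,k),l})=v_{(k-1,l)}$,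 $t(e^-_{(k-1,k),l})=v_{(k,l)}$, $s(e^+_{k,(l,l+1)})=v_{(k,l)}$, $t(e^+_{k,(l,l+1)})=v_{(k,l+1)}$, and such that there is $(x_n)_{n\in\mathbb{Z}}\in\Sigma^{\mathbb{Z}}$ with $\lambda^-(e^-_{(k-1,k),l})=x_k$ and $\lambda^+(e^+_{k,(l,l+1)})=x_l$ for all $(k,l)\in\mathbb{Z}^2[<]$. For $v\in V_{(p,q)}$ and $\mu=(\mu_{p+1},\dots,\mu_{q-1})\in P(v)$ let $U_{(\mu;v)}$ be the set of $x\in\mathcal{X}_{\mathcal{L}}$ whose vertex at $(p,q)$ is $v$ and whose labels satisfy $(x_{p+1},\dots,x_{q-1})=\mu$. These sets (over all $(p,q)\in\mathbb{Z}^2[<]$) form a base of the topology of $\mathcal{X}_{\mathcal{L}}$ (a compact totally disconnected metrizable space). The shift $\sigma_{\mathcal{L}}:\mathcal{X}_{\mathcal{L}}\to\mathcal{X}_{\mathcal{L}}$ is the homeomorphism $\sigma_{\mathcal{L}}(x)=\{(v_{(k+1,l+1)},e^-_{(k,k+1),l+1},e^+_{k+1,(l+1,l+2)})\}_{(k,l)}$. **Equivalence relation.** For $(p,q)\in\mathbb{Z}^2[<]$, $\square_{(p,q)}(x)$ is the restriction of $x$ to all $v_{(k,l)},e^-_{(k-1,k),l},e^+_{k,(l,l+1)}$ with $k\le p$, $l\ge q$. Put $R_{\mathcal{L}_{(p,q)}}=\{(x,z):\square_{(p,q)}(x)=\square_{(p,q)}(z)\}\subset\mathcal{X}_{\mathcal{L}}\times\mathcal{X}_{\mathcal{L}}$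 with the relative product topology, and $R_{\mathcal{L}}=\bigcup_{(p,q)}R_{\mathcal{L}_{(p,q)}}$ with the inductive limit topology; it is an étale equivalence relation. **Canonical $\lambda$-graph bisystem of a subshift.** Let $\Lambda\subset\Sigma^{\mathbb{Z}}$ be a two-sided subshift with shift $\sigma_\Lambda((a_n)_n)=(a_{n+1})_n$. For $x\in\Lambda$ and $(k,l)\in\mathbb{Z}^2[<]$ let $W_{k,l}(x)$ be the set of words $(a_{k+1},\dots,a_{l-1})$ of length $n(k,l)$ with $(\dots,x_{k-1},x_k,a_{k+1},\dots,a_{l-1},x_l,x_{l+1},\dots)\in\Lambda$. Call $x,z\in\Lambda$ $(k,l)$-centrally equivalent if $W_{k,l}(x)=W_{k,l}(z)$; let $\Omega_{k,l}$ be the (finite) set of classes. $\Omega_{k,l}$ and $\Omega_{k-n,l-n}$ are identified via $\sigma_\Lambda^n$, and $V_{n(k,l)}:=\Omega_{k,l}$. For a class $v\in\Omega_{k,l}$, $x\in v$ and $\beta\in\Sigma$ with $(\beta,a_{k+2},\dots,a_{l-1})\in W_{k,l}(x)$ for some $a_{k+2},\dots,a_{l-1}$, there is an edge $e^-$ of $\mathcal{L}_\Lambda^-$ labeled $\beta$ from $v\in V_{n(k,l)}$ to the class in $\Omega_{k+1,l}=V_{n(k,l)-1}$ of $(\dots,x_{k-1},x_k,\beta,a_{k+2},\dots,a_{l-1},x_l,\dots)$. For $\alpha\in\Sigma$ with $(a_{k+1},\dots,a_{l-2},\alpha)\in W_{k,l}(x)$ for some $a_{k+1},\dots,a_{l-2}$,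 there is an edge $e^+$ of $\mathcal{L}_\Lambda^+$ labeled $\alpha$ from the class in $\Omega_{k,l-1}=V_{n(k,l)-1}$ of $(\dots,x_k,a_{k+1},\dots,a_{l-2},\alpha,x_l,\dots)$ to $v$. (One edge for each triple source, terminal, label.) This is a $\lambda$-graph bisystem $\mathcal{L}_\Lambda=(\mathcal{L}_\Lambda^-,\mathcal{L}_\Lambda^+)$ satisfying FPCC. Write $\mathcal{X}_\Lambda,\sigma_{\mathcal{X}_\Lambda},R_\Lambda$ for $\mathcal{X}_{\mathcal{L}_\Lambda},\sigma_{\mathcal{L}_\Lambda},R_{\mathcal{L}_\Lambda}$. The factor map $\pi:\mathcal{X}_\Lambda\to\Lambda$ is $\pi(x)=(x_n)_{n\in\mathbb{Z}}$ (the label sequence of $x$), a continuous surjection. $\Lambda_1,\Lambda_2$ are topologically conjugate via a homeomorphism $h_\Lambda:\Lambda_1\to\Lambda_2$ if $h_\Lambda\circ\sigma_{\Lambda_1}=\sigma_{\Lambda_2}\circ h_\Lambda$. *)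

theory Defs
  imports "HOL-Analysis.Analysis"
begin

section \<open>Lambda-graph bisystems\<close>

text \<open>
  \<open>Em L l\<close> is the edge set \<open>E\<^sup>-\<close> from level \<open>l + 1\<close> down to level \<open>l\<close>, and \<open>Ep L l\<close> is the
  edge set \<open>E\<^sup>+\<close> from level \<open>l\<close> up to level \<open>l + 1\<close>.
\<close>

record ('v, 'e, 'f, 'a) bisystem =
  V :: "nat \<Rightarrow> 'v set"
  Em :: "nat \<Rightarrow> 'e set"
  Ep :: "nat \<Rightarrow> 'f set"
  src_m :: "'e \<Rightarrow> 'v"
  tgt_m :: "'e \<Rightarrow> 'v"
  lab_m :: "'e \<Rightarrow> 'a"
  src_p :: "'f \<Rightarrow> 'v"
  tgt_p :: "'f \<Rightarrow> 'v"
  lab_p :: "'f \<Rightarrow> 'a"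

text \<open>
  Vertices, minus-edges and plus-edges live in separate components, so only disjointness
  within each of the three families has to be required.
\<close>

locale lambda_graph_bisystem =
  fixes S :: "'a set" and L :: "('v, 'e, 'f, 'a) bisystem"
  assumes finite_alphabet: "finite S"
    and V_fin: "finite (V L l)" "V L l \<noteq> {}"
    and Em_fin: "finite (Em L l)" "Em L l \<noteq> {}"
    and Ep_fin: "finite (Ep L l)" "Ep L l \<noteq> {}"
    and V_disj: "l \<noteq> m \<Longrightarrow> V L l \<inter> V L m = {}"
    and Em_disj: "l \<noteq> m \<Longrightarrow> Em L l \<inter> Em L m = {}"
    and Ep_disj: "l \<noteq> m \<Longrightarrow> Ep L l \<inter> Ep L m = {}"
    and V_0: "is_singleton (V L 0)"
    and Em_ends: "e \<in> Em L l \<Longrightarrow> src_m L e \<in> V L (Suc l) \<and> tgt_m L e \<in> V L l \<and> lab_m L e \<in> S"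
    and Ep_ends: "f \<in> Ep L l \<Longrightarrow> src_p L f \<in> V L l \<and> tgt_p L f \<in> V L (Suc l) \<and> lab_p L f \<in> S"
    and right_resolving: "\<lbrakk>e \<in> Em L l; e' \<in> Em L l; e \<noteq> e'; src_m L e = src_m L e'\<rbrakk>
                            \<Longrightarrow> lab_m L e \<noteq> lab_m L e'"
    and left_resolving: "\<lbrakk>f \<in> Ep L l; f' \<in> Ep L l; f \<noteq> f'; tgt_p L f = tgt_p L f'\<rbrakk>
                            \<Longrightarrow> lab_p L f \<noteq> lab_p L f'"
    and local_property: "\<lbrakk>u \<in> V L l; v \<in> V L (Suc (Suc l))\<rbrakk> \<Longrightarrow>
       \<exists>\<phi>. bij_betw \<phi>
             {(f, e). f \<in> Ep L l \<and> e \<in> Em L (Suc l) \<and>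
                      src_p L f = u \<and> tgt_p L f = tgt_m L e \<and> src_m L e = v}
             {(e, f). e \<in> Em L l \<and> f \<in> Ep L (Suc l) \<and>
                      tgt_m L e = u \<and> src_m L e = src_p L f \<and> tgt_p L f = v} \<and>
           (\<forall>f e e' f'. f \<in> Ep L l \<and> e \<in> Em L (Suc l) \<and>
                      src_p L f = u \<and> tgt_p L f = tgt_m L e \<and> src_m L e = v \<and>
                      \<phi> (f, e) = (e', f') \<longrightarrow> lab_p L f = lab_p L f' \<and> lab_m L e = lab_m L e')"

text \<open>
  \<open>P_words L l v\<close> is the set \<open>P(v)\<close> for a vertex \<open>v\<close> of level \<open>l\<close>.
\<close>

definition P_words :: "('v, 'e, 'f, 'a) bisystem \<Rightarrow> nat \<Rightarrow> 'v \<Rightarrow> 'a list set" where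
  "P_words L l v = {map (lab_p L) fs | fs. length fs = l \<and>
      (\<forall>i<l. fs ! i \<in> Ep L i) \<and>
      (\<forall>i. Suc i < l \<longrightarrow> src_p L (fs ! Suc i) = tgt_p L (fs ! i)) \<and>
      (fs \<noteq> [] \<longrightarrow> tgt_p L (last fs) = v)}"


section \<open>The configuration space\<close>

definition Z2 :: "(int \<times> int) set" where
  "Z2 = {(k, l). k < l}"

definition gap :: "int \<Rightarrow> int \<Rightarrow> nat" where
  "gap k l = nat (l - k - 1)"

text \<open>
  The value of a configuration at \<open>(k, l)\<close> is the triple of the vertex at \<open>(k, l)\<close>, the
  minus-edge at \<open>((k - 1, k), l)\<close> and the plus-edge at \<open>(k, (l, l + 1))\<close>.
  Configurations are functions on \<open>Z2\<close>, i.e. \<open>undefined\<close> outside of it.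
\<close>

type_synonym ('v, 'e, 'f) config = "int \<times> int \<Rightarrow> 'v \<times> 'e \<times> 'f"

abbreviation vert :: "('v, 'e, 'f) config \<Rightarrow> int \<Rightarrow> int \<Rightarrow> 'v" where
  "vert x k l \<equiv> fst (x (k, l))"

abbreviation medge :: "('v, 'e, 'f) config \<Rightarrow> int \<Rightarrow> int \<Rightarrow> 'e" where
  "medge x k l \<equiv> fst (snd (x (k, l)))"

abbreviation pedge :: "('v, 'e, 'f) config \<Rightarrow> int \<Rightarrow> int \<Rightarrow> 'f" where
  "pedge x k l \<equiv> snd (snd (x (k, l)))"

definition has_labels :: "('v, 'e, 'f, 'a) bisystem \<Rightarrow> ('v, 'e, 'f) config \<Rightarrow> (int \<Rightarrow> 'a) \<Rightarrow> bool" where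
  "has_labels L x a \<longleftrightarrow>
     (\<forall>k l. k < l \<longrightarrow> lab_m L (medge x k l) = a k \<and> lab_p L (pedge x k l) = a l)"

definition config_space :: "('v, 'e, 'f, 'a) bisystem \<Rightarrow> ('v, 'e, 'f) config set" where
  "config_space L =
     {x \<in> (\<Pi>\<^sub>E (k, l) \<in> Z2. V L (gap k l) \<times> Em L (gap k l) \<times> Ep L (gap k l)).
        (\<forall>k l. k < l \<longrightarrow>
           src_m L (medge x k l) = vert x (k - 1) l \<and> tgt_m L (medge x k l) = vert x k l \<and>
           src_p L (pedge x k l) = vert x k l \<and> tgt_p L (pedge x k l) = vert x k (l + 1)) \<and>
        (\<exists>a. has_labels L x a)}"

definition label_seq :: "('v, 'e, 'f, 'a) bisystem \<Rightarrow> ('v, 'e, 'f) config \<Rightarrow> (int \<Rightarrow> 'a)" where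
  "label_seq L x = (THE a. has_labels L x a)"

lemma label_seq_eq:
  assumes "has_labels L x a"
  shows "label_seq L x = a"
proof -
  have "b = a" if "has_labels L x b" for b
  proof
    fix k :: int
    have "k < k + 1" by simp
    with that assms show "b k = a k"
      unfolding has_labels_def by metis
  qed
  with assms show ?thesis
    unfolding label_seq_def by blast
qed

definition cyl :: "('v, 'e, 'f, 'a) bisystem \<Rightarrow> int \<Rightarrow> int \<Rightarrow> 'a list \<Rightarrow> 'v \<Rightarrow> ('v, 'e, 'f) config set" where
  "cyl L p q \<mu> v = {x \<in> config_space L. vert x p q = v \<and> map (label_seq L x) [p + 1..q - 1] = \<mu>}"

definition config_topology :: "('v, 'e, 'f, 'a) bisystem \<Rightarrow> ('v, 'e, 'f) config topology" where
  "config_topology L = topology_generated_by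
     {cyl L p q \<mu> v | p q \<mu> v. p < q \<and> v \<in> V L (gap p q) \<and> \<mu> \<in> P_words L (gap p q) v}"

lemma topspace_config_topology: "topspace (config_topology L) = config_space L"
proof
  show "topspace (config_topology L) \<subseteq> config_space L"
    by (auto simp: config_topology_def cyl_def)
next
  show "config_space L \<subseteq> topspace (config_topology L)"
  proof
    fix x assume x: "x \<in> config_space L"
    then have "x (0, 1) \<in> V L (gap 0 1) \<times> Em L (gap 0 1) \<times> Ep L (gap 0 1)"
      unfolding config_space_def Z2_def by (auto dest!: PiE_mem[where x = "(0, 1)"])
    then have "vert x 0 1 \<in> V L (gap 0 1)"
      by auto
    moreover have "[] \<in> P_words L (gap 0 1) (vert x 0 1)"
      by (simp add: P_words_def gap_def)
    moreover have "x \<in> cyl L 0 1 [] (vert x 0 1)"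
      using x by (simp add: cyl_def)
    ultimately show "x \<in> topspace (config_topology L)"
      unfolding config_topology_def topology_generated_by_topspace
      by (intro UnionI[of "cyl L 0 1 [] (vert x 0 1)"]) fastforce+
  qed
qed

definition config_shift :: "('v, 'e, 'f) config \<Rightarrow> ('v, 'e, 'f) config" where
  "config_shift x = (\<lambda>(k, l) \<in> Z2. x (k + 1, l + 1))"


section \<open>The etale equivalence relation\<close>

definition square :: "int \<Rightarrow> int \<Rightarrow> ('v, 'e, 'f) config \<Rightarrow> ('v, 'e, 'f) config" where
  "square p q x = restrict x {(k, l). k \<le> p \<and> q \<le> l}"

definition R_level :: "('v, 'e, 'f, 'a) bisystem \<Rightarrow> int \<Rightarrow> int \<Rightarrow>
    (('v, 'e, 'f) config \<times> ('v, 'e, 'f) config) set" where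
  "R_level L p q = {(x, z) \<in> config_space L \<times> config_space L. square p q x = square p q z}"

definition R_rel :: "('v, 'e, 'f, 'a) bisystem \<Rightarrow>
    (('v, 'e, 'f) config \<times> ('v, 'e, 'f) config) set" where
  "R_rel L = (\<Union>(p, q) \<in> Z2. R_level L p q)"

definition R_level_topology :: "('v, 'e, 'f, 'a) bisystem \<Rightarrow> int \<Rightarrow> int \<Rightarrow>
    (('v, 'e, 'f) config \<times> ('v, 'e, 'f) config) topology" where
  "R_level_topology L p q =
     subtopology (prod_topology (config_topology L) (config_topology L)) (R_level L p q)"

definition R_topology :: "('v, 'e, 'f, 'a) bisystem \<Rightarrow>
    (('v, 'e, 'f) config \<times> ('v, 'e, 'f) config) topology" where
  "R_topology L = topology (\<lambda>U. U \<subseteq> R_rel L \<and>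
     (\<forall>(p, q) \<in> Z2. openin (R_level_topology L p q) (U \<inter> R_level L p q)))"

lemma openin_R_topology:
  "openin (R_topology L) U \<longleftrightarrow> U \<subseteq> R_rel L \<and>
     (\<forall>(p, q) \<in> Z2. openin (R_level_topology L p q) (U \<inter> R_level L p q))"
proof -
  have "istopology (\<lambda>U. U \<subseteq> R_rel L \<and>
     (\<forall>(p, q) \<in> Z2. openin (R_level_topology L p q) (U \<inter> R_level L p q)))" (is "istopology ?T")
    unfolding istopology_def
  proof (intro conjI allI impI)
    fix A B assume "?T A" "?T B"
    moreover have "A \<inter> B \<inter> R_level L p q = (A \<inter> R_level L p q) \<inter> (B \<inter> R_level L p q)" for p q
      by blast
    ultimately show "A \<inter> B \<subseteq> R_rel L"
      and "\<forall>(p, q) \<in> Z2. openin (R_level_topology L p q) (A \<inter> B \<inter> R_level L p q)"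
      by (auto simp del: Int_assoc)
  next
    fix K assume K: "\<forall>A\<in>K. ?T A"
    then show "\<Union>K \<subseteq> R_rel L" by blast
    have "openin (R_level_topology L p q) (\<Union>K \<inter> R_level L p q)" if "(p, q) \<in> Z2" for p q
      unfolding Int_Union2 using K that by (intro openin_Union) auto
    then show "\<forall>(p, q) \<in> Z2. openin (R_level_topology L p q) (\<Union>K \<inter> R_level L p q)"
      by blast
  qed
  then show ?thesis
    unfolding R_topology_def by (simp add: topology_inverse')
qed

lemma topspace_R_topology: "topspace (R_topology L) = R_rel L"
proof
  show "topspace (R_topology L) \<subseteq> R_rel L"
    using openin_R_topology openin_topspace by blast
  have "R_rel L \<inter> R_level L p q = topspace (R_level_topology L p q)" if "(p, q) \<in> Z2" for p q
    using that by (auto simp: R_level_topology_def topspace_config_topology R_rel_def R_level_def)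
  then have "openin (R_topology L) (R_rel L)"
    by (auto simp: openin_R_topology)
  then show "R_rel L \<subseteq> topspace (R_topology L)"
    by (rule openin_subset)
qed


section \<open>Subshifts and their canonical bisystems\<close>

definition shift_by :: "int \<Rightarrow> (int \<Rightarrow> 'a) \<Rightarrow> (int \<Rightarrow> 'a)" where
  "shift_by n a = (\<lambda>i. a (i + n))"

abbreviation shift :: "(int \<Rightarrow> 'a) \<Rightarrow> (int \<Rightarrow> 'a)" where
  "shift \<equiv> shift_by 1"

definition full_shift_topology :: "'a set \<Rightarrow> (int \<Rightarrow> 'a) topology" where
  "full_shift_topology S = product_topology (\<lambda>_. discrete_topology S) UNIV"

definition subshift :: "'a set \<Rightarrow> (int \<Rightarrow> 'a) set \<Rightarrow> bool" where
  "subshift S \<Lambda> \<longleftrightarrow> finite S \<and> closedin (full_shift_topology S) \<Lambda> \<and> shift ` \<Lambda> = \<Lambda>"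

definition subshift_topology :: "'a set \<Rightarrow> (int \<Rightarrow> 'a) set \<Rightarrow> (int \<Rightarrow> 'a) topology" where
  "subshift_topology S \<Lambda> = subtopology (full_shift_topology S) \<Lambda>"

text \<open>
  \<open>fill k w x\<close> overwrites \<open>x\<close> at the positions \<open>k + 1, \<dots>, k + length w\<close> by the word \<open>w\<close>.
\<close>

definition fill :: "int \<Rightarrow> 'a list \<Rightarrow> (int \<Rightarrow> 'a) \<Rightarrow> (int \<Rightarrow> 'a)" where
  "fill k w x = (\<lambda>i. if k < i \<and> i \<le> k + int (length w) then w ! nat (i - k - 1) else x i)"

definition W :: "(int \<Rightarrow> 'a) set \<Rightarrow> int \<Rightarrow> int \<Rightarrow> (int \<Rightarrow> 'a) \<Rightarrow> 'a list set" where
  "W \<Lambda> k l x = {w. length w = gap k l \<and> fill k w x \<in> \<Lambda>}"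

definition central_rel :: "(int \<Rightarrow> 'a) set \<Rightarrow> int \<Rightarrow> int \<Rightarrow> ((int \<Rightarrow> 'a) \<times> (int \<Rightarrow> 'a)) set" where
  "central_rel \<Lambda> k l = {(x, z) \<in> \<Lambda> \<times> \<Lambda>. W \<Lambda> k l x = W \<Lambda> k l z}"

definition Omega :: "(int \<Rightarrow> 'a) set \<Rightarrow> int \<Rightarrow> int \<Rightarrow> (int \<Rightarrow> 'a) set set" where
  "Omega \<Lambda> k l = \<Lambda> // central_rel \<Lambda> k l"

text \<open>
  \<open>Omega \<Lambda> k l\<close> is identified with \<open>Omega \<Lambda> 0 (l - k)\<close> via the \<open>k\<close>-th power of the shift, so the
  vertices of level \<open>n\<close> are the elements of \<open>Omega \<Lambda> 0 (n + 1)\<close>, tagged with \<open>n\<close> to keep different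
  levels disjoint. \<open>cvertex \<Lambda> k l x\<close> is the vertex given by the \<open>(k, l)\<close>-central class of \<open>x\<close>.
\<close>

type_synonym 'a cvert = "nat \<times> (int \<Rightarrow> 'a) set"
type_synonym 'a cedge = "'a cvert \<times> 'a cvert \<times> 'a"

definition cvertex :: "(int \<Rightarrow> 'a) set \<Rightarrow> int \<Rightarrow> int \<Rightarrow> (int \<Rightarrow> 'a) \<Rightarrow> 'a cvert" where
  "cvertex \<Lambda> k l x = (gap k l, shift_by k ` (central_rel \<Lambda> k l `` {x}))"

text \<open>
  Edges are triples of source, terminal and label.
\<close>

definition canonical_bisystem ::
    "(int \<Rightarrow> 'a) set \<Rightarrow> ('a cvert, 'a cedge, 'a cedge, 'a) bisystem" where
  "canonical_bisystem \<Lambda> =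
     \<lparr>V = (\<lambda>n. {n} \<times> Omega \<Lambda> 0 (int n + 1)),
      Em = (\<lambda>n. {(cvertex \<Lambda> k l x, cvertex \<Lambda> (k + 1) l (fill k (\<beta> # w) x), \<beta>) | k l x \<beta> w.
                    k < l \<and> gap k l = Suc n \<and> x \<in> \<Lambda> \<and> \<beta> # w \<in> W \<Lambda> k l x}),
      Ep = (\<lambda>n. {(cvertex \<Lambda> k (l - 1) (fill k (w @ [\<alpha>]) x), cvertex \<Lambda> k l x, \<alpha>) | k l x \<alpha> w.
                    k < l \<and> gap k l = Suc n \<and> x \<in> \<Lambda> \<and> w @ [\<alpha>] \<in> W \<Lambda> k l x}),
      src_m = fst, tgt_m = fst \<circ> snd, lab_m = snd \<circ> snd,
      src_p = fst, tgt_p = fst \<circ> snd, lab_p = snd \<circ> snd\<rparr>"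

abbreviation "X_space \<Lambda> \<equiv> config_space (canonical_bisystem \<Lambda>)"
abbreviation "X_topology \<Lambda> \<equiv> config_topology (canonical_bisystem \<Lambda>)"
abbreviation "RL_rel \<Lambda> \<equiv> R_rel (canonical_bisystem \<Lambda>)"
abbreviation "RL_topology \<Lambda> \<equiv> R_topology (canonical_bisystem \<Lambda>)"
abbreviation "factor_map \<Lambda> \<equiv> label_seq (canonical_bisystem \<Lambda>)"

definition conjugate_via ::
    "'a set \<Rightarrow> (int \<Rightarrow> 'a) set \<Rightarrow> 'b set \<Rightarrow> (int \<Rightarrow> 'b) set \<Rightarrow> ((int \<Rightarrow> 'a) \<Rightarrow> (int \<Rightarrow> 'b)) \<Rightarrow> bool" where
  "conjugate_via S1 \<Lambda>1 S2 \<Lambda>2 g \<longleftrightarrow>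
     homeomorphic_map (subshift_topology S1 \<Lambda>1) (subshift_topology S2 \<Lambda>2) g \<and>
     (\<forall>a\<in>\<Lambda>1. g (shift a) = shift (g a))"


section \<open>The canonical bisystem of a nonempty subshift is a lambda-graph bisystem\<close>

lemma shift_by_shift_by [simp]: "shift_by m (shift_by n a) = shift_by (m + n) a"
  by (simp add: shift_by_def fun_eq_iff algebra_simps)

lemma shift_by_0 [simp]: "shift_by 0 a = a"
  by (simp add: shift_by_def)

lemma shift_by_in_subshift:
  assumes "subshift S \<Lambda>"
  shows "shift_by n a \<in> \<Lambda> \<longleftrightarrow> a \<in> \<Lambda>"
proof -
  have sh: "shift ` \<Lambda> = \<Lambda>" using assms by (simp add: subshift_def)
  have step: "shift a \<in> \<Lambda> \<longleftrightarrow> a \<in> \<Lambda>" for a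
  proof
    assume "shift a \<in> \<Lambda>"
    then obtain b where b: "b \<in> \<Lambda>" "shift a = shift b" using sh by (metis imageE)
    have "shift_by (-1) (shift a) = shift_by (-1) (shift b)" using b(2) by (rule arg_cong)
    then have "a = b" by simp
    then show "a \<in> \<Lambda>" using b(1) by simp
  qed (use sh in blast)
  have pos: "shift_by (int m) a \<in> \<Lambda> \<longleftrightarrow> a \<in> \<Lambda>" for m a
  proof (induction m)
    case (Suc m)
    have "shift_by (int (Suc m)) a = shift (shift_by (int m) a)" by (simp add: add.commute)
    then show ?case using Suc step by metis
  qed simp
  show ?thesis
  proof (cases "n \<ge> 0")
    case True then show ?thesis using pos[of "nat n" a] by simp
  next
    case False
    then show ?thesis using pos[of "nat (- n)" "shift_by n a"] by simp
  qed
qed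

lemma shift_by_fill: "shift_by n (fill k w x) = fill (k - n) w (shift_by n x)"
  by (auto simp: shift_by_def fill_def fun_eq_iff algebra_simps)

lemma W_shift_by:
  assumes "subshift S \<Lambda>"
  shows "W \<Lambda> k l (shift_by n x) = W \<Lambda> (k + n) (l + n) x"
proof -
  have "fill k w (shift_by n x) = shift_by n (fill (k + n) w x)" for w
    by (simp add: shift_by_fill)
  then show ?thesis
    by (simp add: W_def gap_def shift_by_in_subshift[OF assms])
qed

lemma cvertex_eq:
  assumes "subshift S \<Lambda>" "x \<in> \<Lambda>" "k < l"
  shows "cvertex \<Lambda> k l x = (gap k l, {z \<in> \<Lambda>. W \<Lambda> 0 (l - k) z = W \<Lambda> k l x})"
proof -
  have "shift_by k ` {z \<in> \<Lambda>. W \<Lambda> k l x = W \<Lambda> k l z} = {z \<in> \<Lambda>. W \<Lambda> 0 (l - k) z = W \<Lambda> k l x}"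
  proof (intro equalityI subsetI)
    fix z assume z: "z \<in> {z \<in> \<Lambda>. W \<Lambda> 0 (l - k) z = W \<Lambda> k l x}"
    then have "shift_by (- k) z \<in> {z \<in> \<Lambda>. W \<Lambda> k l x = W \<Lambda> k l z}"
      by (simp add: shift_by_in_subshift[OF assms(1)] W_shift_by[OF assms(1)])
    moreover have "z = shift_by k (shift_by (- k) z)" by simp
    ultimately show "z \<in> shift_by k ` {z \<in> \<Lambda>. W \<Lambda> k l x = W \<Lambda> k l z}" by blast
  next
    fix y assume "y \<in> shift_by k ` {z \<in> \<Lambda>. W \<Lambda> k l x = W \<Lambda> k l z}"
    then obtain z where z: "y = shift_by k z" "z \<in> \<Lambda>" "W \<Lambda> k l z = W \<Lambda> k l x"
      by auto
    then show "y \<in> {z \<in> \<Lambda>. W \<Lambda> 0 (l - k) z = W \<Lambda> k l x}"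
      by (simp add: shift_by_in_subshift[OF assms(1)] W_shift_by[OF assms(1)])
  qed
  moreover have "central_rel \<Lambda> k l `` {x} = {z \<in> \<Lambda>. W \<Lambda> k l x = W \<Lambda> k l z}"
    using assms(2) unfolding central_rel_def by blast
  ultimately show ?thesis by (simp add: cvertex_def)
qed

lemma cvertex_eq_iff:
  assumes "subshift S \<Lambda>" "x \<in> \<Lambda>" "z \<in> \<Lambda>" "k < l" "k' < l'"
  shows "cvertex \<Lambda> k l x = cvertex \<Lambda> k' l' z \<longleftrightarrow> l - k = l' - k' \<and> W \<Lambda> k l x = W \<Lambda> k' l' z"
proof -
  have x: "shift_by k x \<in> \<Lambda>" "W \<Lambda> 0 (l - k) (shift_by k x) = W \<Lambda> k l x"
    using assms(2) by (auto simp: shift_by_in_subshift[OF assms(1)] W_shift_by[OF assms(1)])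
  have gap: "gap k l = gap k' l' \<longleftrightarrow> l - k = l' - k'"
    using assms(4,5) by (auto simp: gap_def)
  have "{a \<in> \<Lambda>. W \<Lambda> 0 (l - k) a = W \<Lambda> k l x} = {a \<in> \<Lambda>. W \<Lambda> 0 (l - k) a = A} \<longleftrightarrow>
      W \<Lambda> k l x = A" for A
    using x by blast
  then show ?thesis
    unfolding cvertex_eq[OF assms(1,2,4)] cvertex_eq[OF assms(1,3,5)] prod.inject gap
    by (cases "l - k = l' - k'") simp_all
qed

lemma V_canonical:
  assumes "subshift S \<Lambda>"
  shows "V (canonical_bisystem \<Lambda>) n = cvertex \<Lambda> 0 (int n + 1) ` \<Lambda>"
  by (auto simp: canonical_bisystem_def Omega_def quotient_def cvertex_def gap_def image_iff)

lemma cvertex_shift: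
  assumes "subshift S \<Lambda>" "x \<in> \<Lambda>" "k < l"
  shows "cvertex \<Lambda> k l x = cvertex \<Lambda> 0 (int (gap k l) + 1) (shift_by k x)"
  by (subst cvertex_eq_iff[OF assms(1)])
    (use assms(2,3) in \<open>auto simp: shift_by_in_subshift[OF assms(1)] W_shift_by[OF assms(1)] gap_def\<close>)

lemma fill_fill_Cons: 
  assumes "length u = length w"
  shows "fill (k + 1) u (fill k (b # w) x) = fill k (b # u) x"
proof
  fix i
  show "fill (k + 1) u (fill k (b # w) x) i = fill k (b # u) x i"
  proof (cases "i = k + 1")
    case False
    then have "k < i \<Longrightarrow> nat (i - k - 1) = Suc (nat (i - k - 2))" by auto
    moreover have "i - (k + 1) - 1 = i - k - 2" by simp
    ultimately show ?thesis using assms False by (auto simp: fill_def)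
  qed (auto simp: fill_def)
qed

lemma fill_fill_snoc: 
  assumes "length u = length w"
  shows "fill k u (fill k (w @ [a]) x) = fill k (u @ [a]) x"
  using assms by (auto simp: fill_def fun_eq_iff nth_append)

lemma W_fill_Cons:
  assumes "b # w \<in> W \<Lambda> k l x"
  shows "W \<Lambda> (k + 1) l (fill k (b # w) x) = {u. b # u \<in> W \<Lambda> k l x}"
proof -
  have "Suc (length w) = gap k l" "gap k l = Suc (gap (k + 1) l)"
    using assms by (auto simp: W_def gap_def)
  then show ?thesis by (auto simp: W_def fill_fill_Cons)
qed

lemma W_fill_snoc:
  assumes "w @ [a] \<in> W \<Lambda> k l x"
  shows "W \<Lambda> k (l - 1) (fill k (w @ [a]) x) = {u. u @ [a] \<in> W \<Lambda> k l x}"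
proof -
  have "Suc (length w) = gap k l" "gap k l = Suc (gap k (l - 1))"
    using assms by (auto simp: W_def gap_def)
  then show ?thesis by (auto simp: W_def fill_fill_snoc)
qed

lemma fill_self: "fill k (map x [k + 1..l - 1]) x = x"
  by (auto simp: fill_def fun_eq_iff)

lemma W_nonempty: "x \<in> \<Lambda> \<Longrightarrow> map x [k + 1..l - 1] \<in> W \<Lambda> k l x"
  by (simp add: W_def fill_self gap_def)

lemma W_alphabet:
  assumes "subshift S \<Lambda>" "w \<in> W \<Lambda> k l x"
  shows "set w \<subseteq> S"
proof
  fix a assume "a \<in> set w"
  then obtain i where i: "i < length w" "a = w ! i" by (metis in_set_conv_nth)
  have "\<Lambda> \<subseteq> topspace (full_shift_topology S)"
    using assms(1) by (simp add: subshift_def closedin_subset)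
  then have "fill k w x (k + 1 + int i) \<in> S"
    using assms(2) by (auto simp: W_def full_shift_topology_def PiE_def Pi_def)
  then show "a \<in> S" using i by (simp add: fill_def)
qed

lemma Em_canonical:
  assumes "subshift S \<Lambda>"
  shows "Em (canonical_bisystem \<Lambda>) n =
    {(cvertex \<Lambda> 0 (int n + 2) x, cvertex \<Lambda> 0 (int n + 1) y, \<beta>) | x y \<beta>.
       x \<in> \<Lambda> \<and> y \<in> \<Lambda> \<and> W \<Lambda> 0 (int n + 1) y = {u. \<beta> # u \<in> W \<Lambda> 0 (int n + 2) x}}" (is "_ = ?R")
proof (intro equalityI subsetI)
  fix e assume "e \<in> Em (canonical_bisystem \<Lambda>) n"
  then obtain k l x \<beta> w where *: "e = (cvertex \<Lambda> k l x, cvertex \<Lambda> (k + 1) l (fill k (\<beta> # w) x), \<beta>)"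
    "k < l" "gap k l = Suc n" "x \<in> \<Lambda>" "\<beta> # w \<in> W \<Lambda> k l x"
    by (auto simp: canonical_bisystem_def)
  let ?y = "fill k (\<beta> # w) x"
  have l: "l = k + int n + 2" using * by (simp add: gap_def)
  have g: "gap (k + 1) l = n" using l by (simp add: gap_def)
  have y: "?y \<in> \<Lambda>" using * by (simp add: W_def)
  have "cvertex \<Lambda> k l x = cvertex \<Lambda> 0 (int n + 2) (shift_by k x)"
    using *(2,3,4) by (subst cvertex_shift[OF assms]) (auto simp: add.commute)
  moreover have "cvertex \<Lambda> (k + 1) l ?y = cvertex \<Lambda> 0 (int n + 1) (shift_by (k + 1) ?y)"
    using g l y by (subst cvertex_shift[OF assms]) auto
  moreover have "W \<Lambda> 0 (int n + 1) (shift_by (k + 1) ?y) =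
     {u. \<beta> # u \<in> W \<Lambda> 0 (int n + 2) (shift_by k x)}"
  proof -
    have "W \<Lambda> 0 (int n + 1) (shift_by (k + 1) ?y) = W \<Lambda> (k + 1) l ?y"
      by (simp add: W_shift_by[OF assms] l algebra_simps)
    also have "\<dots> = {u. \<beta> # u \<in> W \<Lambda> k l x}" by (rule W_fill_Cons[OF *(5)])
    also have "W \<Lambda> k l x = W \<Lambda> 0 (int n + 2) (shift_by k x)"
      by (simp add: W_shift_by[OF assms] l algebra_simps)
    finally show ?thesis .
  qed
  moreover have "shift_by k x \<in> \<Lambda>" "shift_by (k + 1) ?y \<in> \<Lambda>"
    using *(4) y by (simp_all add: shift_by_in_subshift[OF assms])
  ultimately show "e \<in> ?R"
    unfolding *(1) by blast
next
  fix e assume "e \<in> ?R"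
  then obtain x y \<beta> where *: "e = (cvertex \<Lambda> 0 (int n + 2) x, cvertex \<Lambda> 0 (int n + 1) y, \<beta>)"
    "x \<in> \<Lambda>" "y \<in> \<Lambda>" "W \<Lambda> 0 (int n + 1) y = {u. \<beta> # u \<in> W \<Lambda> 0 (int n + 2) x}" by blast
  define w where "w = map y [1..int n]"
  have w: "\<beta> # w \<in> W \<Lambda> 0 (int n + 2) x"
    using W_nonempty[OF *(3), of 0 "int n + 1"] *(4) by (simp add: w_def)
  then have "fill 0 (\<beta> # w) x \<in> \<Lambda>" by (simp add: W_def)
  then have "cvertex \<Lambda> 0 (int n + 1) y = cvertex \<Lambda> (0 + 1) (int n + 2) (fill 0 (\<beta> # w) x)"
    using *(3,4) W_fill_Cons[OF w] by (subst cvertex_eq_iff[OF assms]) auto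
  moreover have "0 < int n + 2" "gap 0 (int n + 2) = Suc n"
    by (auto simp: gap_def)
  ultimately show "e \<in> Em (canonical_bisystem \<Lambda>) n"
    using *(2) w unfolding *(1) canonical_bisystem_def bisystem.simps mem_Collect_eq by metis
qed

lemma Ep_canonical:
  assumes "subshift S \<Lambda>"
  shows "Ep (canonical_bisystem \<Lambda>) n =
    {(cvertex \<Lambda> 0 (int n + 1) y, cvertex \<Lambda> 0 (int n + 2) x, \<alpha>) | x y \<alpha>.
       x \<in> \<Lambda> \<and> y \<in> \<Lambda> \<and> W \<Lambda> 0 (int n + 1) y = {u. u @ [\<alpha>] \<in> W \<Lambda> 0 (int n + 2) x}}" (is "_ = ?R")
proof (intro equalityI subsetI)
  fix e assume "e \<in> Ep (canonical_bisystem \<Lambda>) n"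
  then obtain k l x \<alpha> w where *: "e = (cvertex \<Lambda> k (l - 1) (fill k (w @ [\<alpha>]) x), cvertex \<Lambda> k l x, \<alpha>)"
    "k < l" "gap k l = Suc n" "x \<in> \<Lambda>" "w @ [\<alpha>] \<in> W \<Lambda> k l x"
    by (auto simp: canonical_bisystem_def)
  let ?y = "fill k (w @ [\<alpha>]) x"
  have l: "l = k + int n + 2" using * by (simp add: gap_def)
  have g: "gap k (l - 1) = n" using l by (simp add: gap_def)
  have y: "?y \<in> \<Lambda>" using * by (simp add: W_def)
  have "cvertex \<Lambda> k l x = cvertex \<Lambda> 0 (int n + 2) (shift_by k x)"
    using *(2,3,4) by (subst cvertex_shift[OF assms]) (auto simp: add.commute)
  moreover have "cvertex \<Lambda> k (l - 1) ?y = cvertex \<Lambda> 0 (int n + 1) (shift_by k ?y)"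
    using g l y by (subst cvertex_shift[OF assms]) auto
  moreover have "W \<Lambda> 0 (int n + 1) (shift_by k ?y) =
     {u. u @ [\<alpha>] \<in> W \<Lambda> 0 (int n + 2) (shift_by k x)}"
  proof -
    have "W \<Lambda> 0 (int n + 1) (shift_by k ?y) = W \<Lambda> k (l - 1) ?y"
      by (simp add: W_shift_by[OF assms] l algebra_simps)
    also have "\<dots> = {u. u @ [\<alpha>] \<in> W \<Lambda> k l x}" by (rule W_fill_snoc[OF *(5)])
    also have "W \<Lambda> k l x = W \<Lambda> 0 (int n + 2) (shift_by k x)"
      by (simp add: W_shift_by[OF assms] l algebra_simps)
    finally show ?thesis .
  qed
  moreover have "shift_by k x \<in> \<Lambda>" "shift_by k ?y \<in> \<Lambda>"
    using *(4) y by (simp_all add: shift_by_in_subshift[OF assms])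
  ultimately show "e \<in> ?R"
    unfolding *(1) by blast
next
  fix e assume "e \<in> ?R"
  then obtain x y \<alpha> where *: "e = (cvertex \<Lambda> 0 (int n + 1) y, cvertex \<Lambda> 0 (int n + 2) x, \<alpha>)"
    "x \<in> \<Lambda>" "y \<in> \<Lambda>" "W \<Lambda> 0 (int n + 1) y = {u. u @ [\<alpha>] \<in> W \<Lambda> 0 (int n + 2) x}" by blast
  define w where "w = map y [1..int n]"
  have w: "w @ [\<alpha>] \<in> W \<Lambda> 0 (int n + 2) x"
    using W_nonempty[OF *(3), of 0 "int n + 1"] *(4) by (simp add: w_def)
  then have "fill 0 (w @ [\<alpha>]) x \<in> \<Lambda>" by (simp add: W_def)
  then have "cvertex \<Lambda> 0 (int n + 1) y = cvertex \<Lambda> 0 (int n + 2 - 1) (fill 0 (w @ [\<alpha>]) x)"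
    using *(3,4) W_fill_snoc[OF w] by (subst cvertex_eq_iff[OF assms]) auto
  moreover have "0 < int n + 2" "gap 0 (int n + 2) = Suc n"
    by (auto simp: gap_def)
  ultimately show "e \<in> Ep (canonical_bisystem \<Lambda>) n"
    using *(2) w unfolding *(1) canonical_bisystem_def bisystem.simps mem_Collect_eq by metis
qed

lemma Omega_finite:
  assumes "subshift S \<Lambda>"
  shows "finite (cvertex \<Lambda> 0 (int n + 1) ` \<Lambda>)"
proof -
  have "finite S" using assms by (simp add: subshift_def)
  have "length w = n" if "w \<in> W \<Lambda> 0 (int n + 1) x" for w x
    using that by (simp add: W_def gap_def)
  then have "W \<Lambda> 0 (int n + 1) ` \<Lambda> \<subseteq> Pow {w. set w \<subseteq> S \<and> length w = n}"
    using W_alphabet[OF assms] by blast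
  then have "finite (W \<Lambda> 0 (int n + 1) ` \<Lambda>)"
    using finite_lists_length_eq[OF \<open>finite S\<close>] by (meson finite_Pow_iff finite_subset)
  moreover have "cvertex \<Lambda> 0 (int n + 1) ` \<Lambda> \<subseteq>
      (\<lambda>A. (n, {z \<in> \<Lambda>. W \<Lambda> 0 (int n + 1) z = A})) ` (W \<Lambda> 0 (int n + 1) ` \<Lambda>)"
    by (auto simp: cvertex_eq[OF assms] gap_def)
  ultimately show ?thesis by (meson finite_imageI finite_subset)
qed

lemma bij_betw_via:
  assumes "inj_on f A" "inj_on g B" "f ` A = g ` B"
  shows "\<exists>\<phi>. bij_betw \<phi> A B \<and> (\<forall>a\<in>A. g (\<phi> a) = f a)"
proof -
  have "bij_betw (the_inv_into B g \<circ> f) A B"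
    using assms bij_betw_the_inv_into[of g B "g ` B"]
    by (intro bij_betw_trans[of f A "f ` A"]) (auto simp: bij_betw_def)
  moreover have "\<forall>a\<in>A. g ((the_inv_into B g \<circ> f) a) = f a"
    using assms by (auto intro!: f_the_inv_into_f)
  ultimately show ?thesis by blast
qed

theorem canonical_lambda_graph_bisystem:
  assumes sub: "subshift S \<Lambda>" and ne: "\<Lambda> \<noteq> {}"
  shows "lambda_graph_bisystem S (canonical_bisystem \<Lambda>)"
proof -
  let ?L = "canonical_bisystem \<Lambda>"
  define c where "c n = cvertex \<Lambda> 0 (int n + 1)" for n
  define w where "w n = W \<Lambda> 0 (int n + 1)" for n
  have Vc: "V ?L n = c n ` \<Lambda>" for n
    by (simp add: V_canonical[OF sub] c_def)
  have Emc: "Em ?L n = {(c (Suc n) x, c n y, \<beta>) | x y \<beta>. x \<in> \<Lambda> \<and> y \<in> \<Lambda> \<and>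
      w n y = {u. \<beta> # u \<in> w (Suc n) x}}" for n
    by (simp add: Em_canonical[OF sub] c_def w_def add.commute)
  have Epc: "Ep ?L n = {(c n y, c (Suc n) x, \<alpha>) | x y \<alpha>. x \<in> \<Lambda> \<and> y \<in> \<Lambda> \<and>
      w n y = {u. u @ [\<alpha>] \<in> w (Suc n) x}}" for n
    by (simp add: Ep_canonical[OF sub] c_def w_def add.commute)
  have c_iff: "c m x = c n y \<longleftrightarrow> m = n \<and> w m x = w n y" if "x \<in> \<Lambda>" "y \<in> \<Lambda>" for m n x y
    using that by (auto simp: c_def w_def cvertex_eq_iff[OF sub])
  have wne: "w n x \<noteq> {}" if "x \<in> \<Lambda>" for n x
    using W_nonempty[OF that] by (auto simp: w_def)
  have wlen: "u \<in> w n x \<Longrightarrow> length u = n" for u n x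
    by (auto simp: w_def W_def gap_def)
  have wS: "u \<in> w n x \<Longrightarrow> set u \<subseteq> S" for u n x
    using W_alphabet[OF sub] by (auto simp: w_def)
  have left: "\<exists>y\<in>\<Lambda>. w n y = {u. \<beta> # u \<in> w (Suc n) x}" if "\<beta> # u \<in> w (Suc n) x" for n \<beta> u x
  proof -
    have "W \<Lambda> (0 + 1) (int n + 2) (fill 0 (\<beta> # u) x) = {u. \<beta> # u \<in> W \<Lambda> 0 (int n + 2) x}"
      using that by (intro W_fill_Cons) (simp add: w_def add.commute)
    moreover have "fill 0 (\<beta> # u) x \<in> \<Lambda>" using that by (simp add: w_def W_def)
    ultimately show ?thesis
      by (intro bexI[of _ "shift (fill 0 (\<beta> # u) x)"])
        (auto simp: w_def W_shift_by[OF sub] shift_by_in_subshift[OF sub] add.commute)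
  qed
  have right: "\<exists>y\<in>\<Lambda>. w n y = {u. u @ [\<alpha>] \<in> w (Suc n) x}" if "u @ [\<alpha>] \<in> w (Suc n) x" for n \<alpha> u x
  proof -
    have "W \<Lambda> 0 (int n + 2 - 1) (fill 0 (u @ [\<alpha>]) x) = {u. u @ [\<alpha>] \<in> W \<Lambda> 0 (int n + 2) x}"
      using that by (intro W_fill_snoc) (simp add: w_def add.commute)
    moreover have "fill 0 (u @ [\<alpha>]) x \<in> \<Lambda>" using that by (simp add: w_def W_def)
    ultimately show ?thesis
      by (intro bexI[of _ "fill 0 (u @ [\<alpha>]) x"]) (auto simp: w_def add.commute)
  qed
  have Em_iff: "(c (Suc n) x, t, \<beta>) \<in> Em ?L n \<longleftrightarrow>
      (\<exists>r\<in>\<Lambda>. t = c n r \<and> w n r = {u. \<beta> # u \<in> w (Suc n) x})" if "x \<in> \<Lambda>" for n x t \<beta>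
  proof
    assume "(c (Suc n) x, t, \<beta>) \<in> Em ?L n"
    then obtain x' r where *: "x' \<in> \<Lambda>" "r \<in> \<Lambda>" "c (Suc n) x = c (Suc n) x'" "t = c n r"
      "w n r = {u. \<beta> # u \<in> w (Suc n) x'}" unfolding Emc by blast
    then have "w (Suc n) x = w (Suc n) x'" using c_iff[OF that *(1)] by blast
    with * show "\<exists>r\<in>\<Lambda>. t = c n r \<and> w n r = {u. \<beta> # u \<in> w (Suc n) x}" by metis
  qed (use that in \<open>unfold Emc, blast\<close>)
  have Ep_iff: "(t, c (Suc n) x, \<alpha>) \<in> Ep ?L n \<longleftrightarrow>
      (\<exists>r\<in>\<Lambda>. t = c n r \<and> w n r = {u. u @ [\<alpha>] \<in> w (Suc n) x})" if "x \<in> \<Lambda>" for n x t \<alpha>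
  proof
    assume "(t, c (Suc n) x, \<alpha>) \<in> Ep ?L n"
    then obtain x' r where *: "x' \<in> \<Lambda>" "r \<in> \<Lambda>" "c (Suc n) x = c (Suc n) x'" "t = c n r"
      "w n r = {u. u @ [\<alpha>] \<in> w (Suc n) x'}" unfolding Epc by blast
    then have "w (Suc n) x = w (Suc n) x'" using c_iff[OF that *(1)] by blast
    with * show "\<exists>r\<in>\<Lambda>. t = c n r \<and> w n r = {u. u @ [\<alpha>] \<in> w (Suc n) x}" by metis
  qed (use that in \<open>unfold Epc, blast\<close>)
  have Em_src: "\<exists>x\<in>\<Lambda>. s = c (Suc n) x" if "(s, t, \<beta>) \<in> Em ?L n" for s t \<beta> n
    using that unfolding Emc by blast
  have Ep_tgt: "\<exists>x\<in>\<Lambda>. s = c (Suc n) x" if "(t, s, \<alpha>) \<in> Ep ?L n" for s t \<alpha> n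
    using that unfolding Epc by blast
  have Em_det: "t = t'" if tt: "(s, t, \<beta>) \<in> Em ?L n" "(s, t', \<beta>) \<in> Em ?L n" for s t t' \<beta> n
  proof -
    obtain x where x: "x \<in> \<Lambda>" "s = c (Suc n) x" using Em_src[OF tt(1)] by blast
    obtain r r' where "r \<in> \<Lambda>" "r' \<in> \<Lambda>" "t = c n r" "t' = c n r'" "w n r = w n r'"
      using tt unfolding x(2) Em_iff[OF x(1)] by fast
    then show ?thesis using c_iff[of r r' n n] by blast
  qed
  have Ep_det: "t = t'" if tt: "(t, s, \<alpha>) \<in> Ep ?L n" "(t', s, \<alpha>) \<in> Ep ?L n" for s t t' \<alpha> n
  proof -
    obtain x where x: "x \<in> \<Lambda>" "s = c (Suc n) x" using Ep_tgt[OF tt(1)] by blast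
    obtain r r' where "r \<in> \<Lambda>" "r' \<in> \<Lambda>" "t = c n r" "t' = c n r'" "w n r = w n r'"
      using tt unfolding x(2) Ep_iff[OF x(1)] by fast
    then show ?thesis using c_iff[of r r' n n] by blast
  qed
  have sel: "src_m ?L = fst" "tgt_m ?L = fst \<circ> snd" "lab_m ?L = snd \<circ> snd"
     "src_p ?L = fst" "tgt_p ?L = fst \<circ> snd" "lab_p ?L = snd \<circ> snd"
    by (auto simp: canonical_bisystem_def)
  have finS: "finite S" using sub by (simp add: subshift_def)
  have finV: "finite (V ?L n)" for n
    using Omega_finite[OF sub] by (simp add: Vc c_def)
  have Em_sub: "Em ?L n \<subseteq> V ?L (Suc n) \<times> V ?L n \<times> S" for n
  proof
    fix e assume "e \<in> Em ?L n"
    then obtain x y \<beta> where e: "e = (c (Suc n) x, c n y, \<beta>)" "x \<in> \<Lambda>" "y \<in> \<Lambda>"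
      "w n y = {u. \<beta> # u \<in> w (Suc n) x}" unfolding Emc by blast
    obtain u where "u \<in> w n y" using wne e by blast
    then have "\<beta> \<in> S" using e wS by fastforce
    with e show "e \<in> V ?L (Suc n) \<times> V ?L n \<times> S" by (auto simp: Vc)
  qed
  have Ep_sub: "Ep ?L n \<subseteq> V ?L n \<times> V ?L (Suc n) \<times> S" for n
  proof
    fix e assume "e \<in> Ep ?L n"
    then obtain x y \<alpha> where e: "e = (c n y, c (Suc n) x, \<alpha>)" "x \<in> \<Lambda>" "y \<in> \<Lambda>"
      "w n y = {u. u @ [\<alpha>] \<in> w (Suc n) x}" unfolding Epc by blast
    obtain u where "u \<in> w n y" using wne e by blast
    then have "\<alpha> \<in> S" using e wS by fastforce
    with e show "e \<in> V ?L n \<times> V ?L (Suc n) \<times> S" by (auto simp: Vc)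
  qed
  have disj: "V ?L l \<inter> V ?L m = {}" if "l \<noteq> m" for l m
    using that by (auto simp: canonical_bisystem_def)
  show ?thesis
  proof
    fix l m :: nat
    show "finite S" by (rule finS)
    show "finite (V ?L l)" by (rule finV)
    show "V ?L l \<noteq> {}" using ne by (simp add: Vc)
    show "finite (Em ?L l)"
      by (rule finite_subset[OF Em_sub]) (simp add: finV finS)
    show "finite (Ep ?L l)"
      by (rule finite_subset[OF Ep_sub]) (simp add: finV finS)
    obtain x where x: "x \<in> \<Lambda>" using ne by blast
    obtain v where v: "v \<in> w (Suc l) x" using wne[OF x] by blast
    then have "v \<noteq> []" using wlen by fastforce
    obtain \<beta> u where "v = \<beta> # u" using \<open>v \<noteq> []\<close> by (cases v) auto
    then obtain y where "y \<in> \<Lambda>" "w l y = {u. \<beta> # u \<in> w (Suc l) x}"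
      using left v by blast
    then have "(c (Suc l) x, c l y, \<beta>) \<in> Em ?L l"
      unfolding Emc using x by blast
    then show "Em ?L l \<noteq> {}" by blast
    obtain \<alpha> u where "v = u @ [\<alpha>]" using \<open>v \<noteq> []\<close> by (cases v rule: rev_cases) auto
    then obtain y where "y \<in> \<Lambda>" "w l y = {u. u @ [\<alpha>] \<in> w (Suc l) x}"
      using right v by blast
    then have "(c l y, c (Suc l) x, \<alpha>) \<in> Ep ?L l"
      unfolding Epc using x by blast
    then show "Ep ?L l \<noteq> {}" by blast
    show "V ?L l \<inter> V ?L m = {}" if "l \<noteq> m" using disj[OF that] .
    show "Em ?L l \<inter> Em ?L m = {}" if "l \<noteq> m"
      using Em_sub[of l] Em_sub[of m] disj[OF that] by blast
    show "Ep ?L l \<inter> Ep ?L m = {}" if "l \<noteq> m"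
      using Ep_sub[of l] Ep_sub[of m] disj[OF that] by blast
    have "w 0 y = {[]}" if "y \<in> \<Lambda>" for y
      using wne[OF that, of 0] wlen[of _ 0 y] by fastforce
    then have "c 0 y = c 0 x" if "y \<in> \<Lambda>" for y using c_iff that x by auto
    then have "V ?L 0 = {c 0 x}" unfolding Vc using x by blast
    then show "is_singleton (V ?L 0)" by (rule ssubst) (rule is_singletonI)
    show "src_m ?L e \<in> V ?L (Suc l) \<and> tgt_m ?L e \<in> V ?L l \<and> lab_m ?L e \<in> S" if "e \<in> Em ?L l" for e
      using subsetD[OF Em_sub that] by (auto simp: sel)
    show "src_p ?L e \<in> V ?L l \<and> tgt_p ?L e \<in> V ?L (Suc l) \<and> lab_p ?L e \<in> S" if "e \<in> Ep ?L l" for e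
      using subsetD[OF Ep_sub that] by (auto simp: sel)
    show "lab_m ?L e \<noteq> lab_m ?L e'"
      if "e \<in> Em ?L l" "e' \<in> Em ?L l" "e \<noteq> e'" "src_m ?L e = src_m ?L e'" for e e'
    proof
      assume "lab_m ?L e = lab_m ?L e'"
      then have "e = (fst e, fst (snd e), lab_m ?L e)" "e' = (fst e, fst (snd e'), lab_m ?L e)"
        using that(4) by (simp_all add: sel prod_eq_iff)
      with that(1-3) show False using Em_det by metis
    qed
    show "lab_p ?L e \<noteq> lab_p ?L e'"
      if "e \<in> Ep ?L l" "e' \<in> Ep ?L l" "e \<noteq> e'" "tgt_p ?L e = tgt_p ?L e'" for e e'
    proof
      assume "lab_p ?L e = lab_p ?L e'"
      then have "e = (fst e, fst (snd e), lab_p ?L e)" "e' = (fst e', fst (snd e), lab_p ?L e)"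
        using that(4) by (simp_all add: sel prod_eq_iff)
      with that(1-3) show False using Ep_det by metis
    qed
    fix u v assume "u \<in> V ?L l" "v \<in> V ?L (Suc (Suc l))"
    then obtain z y where z: "z \<in> \<Lambda>" "u = c l z" and y: "y \<in> \<Lambda>" "v = c (Suc (Suc l)) y"
      by (auto simp: Vc)
    let ?A = "{(f, e). f \<in> Ep ?L l \<and> e \<in> Em ?L (Suc l) \<and>
                      src_p ?L f = u \<and> tgt_p ?L f = tgt_m ?L e \<and> src_m ?L e = v}"
    let ?B = "{(e, f). e \<in> Em ?L l \<and> f \<in> Ep ?L (Suc l) \<and>
                      tgt_m ?L e = u \<and> src_m ?L e = src_p ?L f \<and> tgt_p ?L f = v}"
    let ?C = "{(\<alpha>, \<beta>). w l z = {s. \<beta> # s @ [\<alpha>] \<in> w (Suc (Suc l)) y}}"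
    define F where "F = (\<lambda>(f, e). (lab_p ?L f, lab_m ?L e))"
    define G where "G = (\<lambda>(e, f). (lab_p ?L f, lab_m ?L e))"
    have A: "?A = {((u, t, \<alpha>), (v, t, \<beta>)) | t \<alpha> \<beta>.
        (u, t, \<alpha>) \<in> Ep ?L l \<and> (v, t, \<beta>) \<in> Em ?L (Suc l)}"
      unfolding sel comp_def by (force simp: prod_eq_iff)
    have B: "?B = {((t, u, \<beta>), (t, v, \<alpha>)) | t \<alpha> \<beta>.
        (t, u, \<beta>) \<in> Em ?L l \<and> (t, v, \<alpha>) \<in> Ep ?L (Suc l)}"
      unfolding sel comp_def by (force simp: prod_eq_iff)
    have injF: "inj_on F ?A"
    proof (rule inj_onI)
      fix p q assume "p \<in> ?A" "q \<in> ?A" and eq: "F p = F q"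
      then obtain t \<alpha> \<beta> t' \<alpha>' \<beta>' where
        p: "p = ((u, t, \<alpha>), (v, t, \<beta>))" "(v, t, \<beta>) \<in> Em ?L (Suc l)" and
        q: "q = ((u, t', \<alpha>'), (v, t', \<beta>'))" "(v, t', \<beta>') \<in> Em ?L (Suc l)"
        unfolding A by blast
      from eq have "\<alpha> = \<alpha>'" "\<beta> = \<beta>'" unfolding p q F_def sel by simp_all
      with p q show "p = q" using Em_det by metis
    qed
    have injG: "inj_on G ?B"
    proof (rule inj_onI)
      fix p q assume "p \<in> ?B" "q \<in> ?B" and eq: "G p = G q"
      then obtain t \<alpha> \<beta> t' \<alpha>' \<beta>' where
        p: "p = ((t, u, \<beta>), (t, v, \<alpha>))" "(t, v, \<alpha>) \<in> Ep ?L (Suc l)" and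
        q: "q = ((t', u, \<beta>'), (t', v, \<alpha>'))" "(t', v, \<alpha>') \<in> Ep ?L (Suc l)"
        unfolding B by blast
      from eq have "\<alpha> = \<alpha>'" "\<beta> = \<beta>'" unfolding p q G_def sel by simp_all
      with p q show "p = q" using Ep_det by metis
    qed
    have FA: "F ` ?A = ?C"
    proof -
      have "(\<exists>t. (u, t, \<alpha>) \<in> Ep ?L l \<and> (v, t, \<beta>) \<in> Em ?L (Suc l)) \<longleftrightarrow> (\<alpha>, \<beta>) \<in> ?C" for \<alpha> \<beta>
      proof
        assume "\<exists>t. (u, t, \<alpha>) \<in> Ep ?L l \<and> (v, t, \<beta>) \<in> Em ?L (Suc l)"
        then obtain t where t: "(u, t, \<alpha>) \<in> Ep ?L l" "(v, t, \<beta>) \<in> Em ?L (Suc l)" by blast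
        then obtain r where r: "r \<in> \<Lambda>" "t = c (Suc l) r" "w (Suc l) r = {s. \<beta> # s \<in> w (Suc (Suc l)) y}"
          unfolding y(2) Em_iff[OF y(1)] by blast
        obtain r' where r': "r' \<in> \<Lambda>" "u = c l r'" "w l r' = {s. s @ [\<alpha>] \<in> w (Suc l) r}"
          using t(1) unfolding r(2) Ep_iff[OF r(1)] by blast
        have "w l z = w l r'"
          using c_iff[OF z(1) r'(1), of l l] z(2) r'(2) by simp
        then have "w l z = {s. s @ [\<alpha>] \<in> w (Suc l) r}"
          unfolding r'(3) .
        then show "(\<alpha>, \<beta>) \<in> ?C" unfolding r(3) by simp
      next
        assume "(\<alpha>, \<beta>) \<in> ?C"
        then have C: "w l z = {s. \<beta> # s @ [\<alpha>] \<in> w (Suc (Suc l)) y}" by simp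
        obtain s where "\<beta> # s @ [\<alpha>] \<in> w (Suc (Suc l)) y" using wne[OF z(1)] C by blast
        then obtain r where r: "r \<in> \<Lambda>" "w (Suc l) r = {s. \<beta> # s \<in> w (Suc (Suc l)) y}"
          using left by blast
        have "w l z = {s. s @ [\<alpha>] \<in> w (Suc l) r}" unfolding C r(2) by simp
        then have "(u, c (Suc l) r, \<alpha>) \<in> Ep ?L l"
          unfolding Ep_iff[OF r(1)] using z by (intro bexI[of _ z] conjI)
        moreover have "(v, c (Suc l) r, \<beta>) \<in> Em ?L (Suc l)"
          unfolding y(2) Em_iff[OF y(1)] using r by (intro bexI[of _ r] conjI refl)
        ultimately show "\<exists>t. (u, t, \<alpha>) \<in> Ep ?L l \<and> (v, t, \<beta>) \<in> Em ?L (Suc l)" by blast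
      qed
      moreover have "F ` ?A = {(\<alpha>, \<beta>). \<exists>t. (u, t, \<alpha>) \<in> Ep ?L l \<and> (v, t, \<beta>) \<in> Em ?L (Suc l)}"
        unfolding A by (force simp: F_def sel)
      ultimately show ?thesis by blast
    qed
    have GB: "G ` ?B = ?C"
    proof -
      have "(\<exists>t. (t, u, \<beta>) \<in> Em ?L l \<and> (t, v, \<alpha>) \<in> Ep ?L (Suc l)) \<longleftrightarrow> (\<alpha>, \<beta>) \<in> ?C" for \<alpha> \<beta>
      proof
        assume "\<exists>t. (t, u, \<beta>) \<in> Em ?L l \<and> (t, v, \<alpha>) \<in> Ep ?L (Suc l)"
        then obtain t where t: "(t, u, \<beta>) \<in> Em ?L l" "(t, v, \<alpha>) \<in> Ep ?L (Suc l)" by blast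
        then obtain r where r: "r \<in> \<Lambda>" "t = c (Suc l) r" "w (Suc l) r = {s. s @ [\<alpha>] \<in> w (Suc (Suc l)) y}"
          unfolding y(2) Ep_iff[OF y(1)] by blast
        obtain r' where r': "r' \<in> \<Lambda>" "u = c l r'" "w l r' = {s. \<beta> # s \<in> w (Suc l) r}"
          using t(1) unfolding r(2) Em_iff[OF r(1)] by blast
        have "w l z = w l r'"
          using c_iff[OF z(1) r'(1), of l l] z(2) r'(2) by simp
        then have "w l z = {s. \<beta> # s \<in> w (Suc l) r}"
          unfolding r'(3) .
        then show "(\<alpha>, \<beta>) \<in> ?C" unfolding r(3) by simp
      next
        assume "(\<alpha>, \<beta>) \<in> ?C"
        then have C: "w l z = {s. \<beta> # s @ [\<alpha>] \<in> w (Suc (Suc l)) y}" by simp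
        obtain s where "\<beta> # s @ [\<alpha>] \<in> w (Suc (Suc l)) y" using wne[OF z(1)] C by blast
        then have "(\<beta> # s) @ [\<alpha>] \<in> w (Suc (Suc l)) y" by simp
        then obtain r where r: "r \<in> \<Lambda>" "w (Suc l) r = {s. s @ [\<alpha>] \<in> w (Suc (Suc l)) y}"
          using right by blast
        have "w l z = {s. \<beta> # s \<in> w (Suc l) r}" unfolding C r(2) by simp
        then have "(c (Suc l) r, u, \<beta>) \<in> Em ?L l"
          unfolding Em_iff[OF r(1)] using z by (intro bexI[of _ z] conjI)
        moreover have "(c (Suc l) r, v, \<alpha>) \<in> Ep ?L (Suc l)"
          unfolding y(2) Ep_iff[OF y(1)] using r by (intro bexI[of _ r] conjI refl)
        ultimately show "\<exists>t. (t, u, \<beta>) \<in> Em ?L l \<and> (t, v, \<alpha>) \<in> Ep ?L (Suc l)" by blast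
      qed
      moreover have "G ` ?B = {(\<alpha>, \<beta>). \<exists>t. (t, u, \<beta>) \<in> Em ?L l \<and> (t, v, \<alpha>) \<in> Ep ?L (Suc l)}"
        unfolding B by (force simp: G_def sel)
      ultimately show ?thesis by blast
    qed
    obtain \<phi> where \<phi>: "bij_betw \<phi> ?A ?B" "\<forall>p\<in>?A. G (\<phi> p) = F p"
      using bij_betw_via[OF injF injG] FA GB by auto
    have "lab_p ?L f = lab_p ?L f' \<and> lab_m ?L e = lab_m ?L e'"
      if "(f, e) \<in> ?A" "\<phi> (f, e) = (e', f')" for f e e' f'
      using \<phi>(2) that by (metis (no_types, lifting) F_def G_def case_prod_conv prod.inject)
    then show "\<exists>\<phi>. bij_betw \<phi> ?A ?B \<and> (\<forall>f e e' f'. f \<in> Ep ?L l \<and> e \<in> Em ?L (Suc l) \<and>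
                      src_p ?L f = u \<and> tgt_p ?L f = tgt_m ?L e \<and> src_m ?L e = v \<and>
                      \<phi> (f, e) = (e', f') \<longrightarrow> lab_p ?L f = lab_p ?L f' \<and> lab_m ?L e = lab_m ?L e')"
      using \<phi>(1) by (intro exI[of _ \<phi>]) auto
  qed
qed

end

theory Submission
  imports Defs
begin

text \<open>
  A configuration of \<open>X_space \<Lambda>\<close> is a label sequence \<open>a\<close> together with a central class at
  every \<open>(k, l)\<close>; the edges carry no further information, being triples of source, target and
  label. On any finite window \<open>(p, q)\<close> these data are those of a single point \<open>y\<close> of \<open>\<Lambda>\<close>: take
  a point representing the class at \<open>(p, q)\<close> and replace its letters inside the window by
  those of \<open>a\<close>. The edges from \<open>(p, q)\<close> to the smaller windows then force \<open>y\<close> to represent the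
  classes of the configuration there as well (\<open>approximants_nonempty\<close>, \<open>approximants_mono\<close>).
  So \<open>X_space \<Lambda>\<close> is a completion of \<open>\<Lambda>\<close> for the structure in which two points are close if on
  a large window they have the same letters and the same central class. A map between
  subshifts extends to the configurations as soon as it is uniformly continuous for this
  structure, and identities between such extensions are inherited from the points.

  A conjugacy \<open>f\<close> and its inverse \<open>g\<close> are sliding block codes of a common radius \<open>N\<close>
  (\<open>curtis_hedlund_lyndon\<close>). This gives the uniform continuity (\<open>cvertex_local\<close>): the central
  class of \<open>f y\<close> at \<open>(k, l)\<close> is determined by the central class of \<open>y\<close> at the window
  \<open>(k - 3 N, l + 3 N)\<close> and by the letters of \<open>y\<close> in that window. Indeed, if a word \<open>w\<close> may be
  filled into the gap \<open>(k, l)\<close> of \<open>f y\<close>, then the filled point has a preimage under \<open>f\<close>. As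
  \<open>g\<close> has radius \<open>N\<close>, this preimage differs from \<open>y\<close> only within distance \<open>N\<close> of the gap, so
  its part in the larger window is a word that may be filled into \<open>y\<close>; and these words are
  what the class of \<open>y\<close> records. The resulting map \<open>lift\<close> is continuous and commutes with the
  shifts, and lifting \<open>g\<close> gives its inverse.

  For the equivalence relations the same lemma is used in its sharp form: the letters of \<open>y\<close>
  that matter lie outside of the gap or at most \<open>N\<close> places inside of it. If two configurations
  agree at all \<open>(k, l)\<close> with \<open>k \<le> p\<close> and \<open>q \<le> l\<close>, then their images therefore agree for
  \<open>k \<le> p - 3 N\<close> and \<open>q + 3 N \<le> l\<close>. Hence \<open>lift\<close> maps each level of the first relation into a
  level of the second one, which is what continuity for the inductive limit topologies asks
  for.
\<close>

section \<open>Configurations of the canonical bisystem\<close>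

lemma canonical_selectors [simp]:
  "src_m (canonical_bisystem \<Lambda>) = fst" "tgt_m (canonical_bisystem \<Lambda>) = fst \<circ> snd"
  "lab_m (canonical_bisystem \<Lambda>) = snd \<circ> snd" "src_p (canonical_bisystem \<Lambda>) = fst"
  "tgt_p (canonical_bisystem \<Lambda>) = fst \<circ> snd" "lab_p (canonical_bisystem \<Lambda>) = snd \<circ> snd"
  by (simp_all add: canonical_bisystem_def)

text \<open>
  The vertices and edges of the canonical bisystem are described at the origin. Since the shift
  identifies the classes at \<open>(k, l)\<close> with those at \<open>(0, l - k)\<close>, the descriptions can be moved to the
  place \<open>(k, l)\<close> where a configuration uses them.
\<close>

lemma V_canonical_at:
  assumes "subshift S \<Lambda>" "k < l"
  shows "V (canonical_bisystem \<Lambda>) (gap k l) = cvertex \<Lambda> k l ` \<Lambda>"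
proof -
  have "cvertex \<Lambda> k l ` \<Lambda> = (\<lambda>x. cvertex \<Lambda> 0 (int (gap k l) + 1) (shift_by k x)) ` \<Lambda>"
    using cvertex_shift[OF assms(1) _ assms(2)] by (intro image_cong) auto
  also have "\<dots> = cvertex \<Lambda> 0 (int (gap k l) + 1) ` (shift_by k ` \<Lambda>)"
    by (simp add: image_image)
  also have "shift_by k ` \<Lambda> = \<Lambda>"
  proof -
    have "z \<in> shift_by k ` \<Lambda>" if "z \<in> \<Lambda>" for z
      using that shift_by_in_subshift[OF assms(1), of "- k" z] by (intro image_eqI[of _ _ "shift_by (- k) z"]) auto
    then show ?thesis using shift_by_in_subshift[OF assms(1)] by auto
  qed
  finally show ?thesis by (simp add: V_canonical[OF assms(1)])
qed

lemma Em_canonical_at: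
  assumes "subshift S \<Lambda>" "k < l" "y \<in> \<Lambda>"
  shows "(cvertex \<Lambda> (k - 1) l y, v, \<beta>) \<in> Em (canonical_bisystem \<Lambda>) (gap k l) \<longleftrightarrow>
    (\<exists>r\<in>\<Lambda>. v = cvertex \<Lambda> k l r \<and> W \<Lambda> k l r = {u. \<beta> # u \<in> W \<Lambda> (k - 1) l y})"
proof -
  let ?n = "gap k l"
  have n: "int ?n = l - k - 1" using assms(2) by (simp add: gap_def)
  show ?thesis
  proof
    assume "(cvertex \<Lambda> (k - 1) l y, v, \<beta>) \<in> Em (canonical_bisystem \<Lambda>) ?n"
    then obtain x r where *: "cvertex \<Lambda> (k - 1) l y = cvertex \<Lambda> 0 (int ?n + 2) x"
      "v = cvertex \<Lambda> 0 (int ?n + 1) r" "x \<in> \<Lambda>" "r \<in> \<Lambda>"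
      "W \<Lambda> 0 (int ?n + 1) r = {u. \<beta> # u \<in> W \<Lambda> 0 (int ?n + 2) x}"
      unfolding Em_canonical[OF assms(1)] by auto
    have "W \<Lambda> 0 (int ?n + 2) x = W \<Lambda> (k - 1) l y"
      using *(1,3) assms n by (subst (asm) cvertex_eq_iff[OF assms(1)]) auto
    moreover have "W \<Lambda> k l (shift_by (- k) r) = W \<Lambda> 0 (int ?n + 1) r"
      by (simp add: W_shift_by[OF assms(1)] n add.commute)
    moreover have "v = cvertex \<Lambda> k l (shift_by (- k) r)"
      using *(2,4) assms(2) n calculation(2)
      by (simp add: cvertex_eq_iff[OF assms(1)] shift_by_in_subshift[OF assms(1)])
    ultimately show "\<exists>r\<in>\<Lambda>. v = cvertex \<Lambda> k l r \<and> W \<Lambda> k l r = {u. \<beta> # u \<in> W \<Lambda> (k - 1) l y}"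
      using *(4,5) shift_by_in_subshift[OF assms(1), of "- k" r] by (intro bexI[of _ "shift_by (- k) r"]) auto
  next
    assume "\<exists>r\<in>\<Lambda>. v = cvertex \<Lambda> k l r \<and> W \<Lambda> k l r = {u. \<beta> # u \<in> W \<Lambda> (k - 1) l y}"
    then obtain r where r: "r \<in> \<Lambda>" "v = cvertex \<Lambda> k l r" "W \<Lambda> k l r = {u. \<beta> # u \<in> W \<Lambda> (k - 1) l y}"
      by blast
    let ?x = "shift_by (k - 1) y" and ?r = "shift_by k r"
    have "W \<Lambda> 0 (int ?n + 1) ?r = W \<Lambda> k l r" "W \<Lambda> 0 (int ?n + 2) ?x = W \<Lambda> (k - 1) l y"
      by (simp_all add: W_shift_by[OF assms(1)] n add.commute)
    moreover have "?x \<in> \<Lambda>" "?r \<in> \<Lambda>"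
      using r assms by (simp_all add: shift_by_in_subshift[OF assms(1)])
    moreover have "cvertex \<Lambda> (k - 1) l y = cvertex \<Lambda> 0 (int ?n + 2) ?x"
      "v = cvertex \<Lambda> 0 (int ?n + 1) ?r"
      using r(1,2) calculation assms n by (simp_all add: cvertex_eq_iff[OF assms(1)])
    ultimately show "(cvertex \<Lambda> (k - 1) l y, v, \<beta>) \<in> Em (canonical_bisystem \<Lambda>) ?n"
      unfolding Em_canonical[OF assms(1)] using r(3) by blast
  qed
qed

lemma Ep_canonical_at:
  assumes "subshift S \<Lambda>" "k < l" "y \<in> \<Lambda>"
  shows "(v, cvertex \<Lambda> k (l + 1) y, \<alpha>) \<in> Ep (canonical_bisystem \<Lambda>) (gap k l) \<longleftrightarrow>
    (\<exists>r\<in>\<Lambda>. v = cvertex \<Lambda> k l r \<and> W \<Lambda> k l r = {u. u @ [\<alpha>] \<in> W \<Lambda> k (l + 1) y})"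
proof -
  let ?n = "gap k l"
  have n: "int ?n = l - k - 1" using assms(2) by (simp add: gap_def)
  show ?thesis
  proof
    assume "(v, cvertex \<Lambda> k (l + 1) y, \<alpha>) \<in> Ep (canonical_bisystem \<Lambda>) ?n"
    then obtain x r where *: "cvertex \<Lambda> k (l + 1) y = cvertex \<Lambda> 0 (int ?n + 2) x"
      "v = cvertex \<Lambda> 0 (int ?n + 1) r" "x \<in> \<Lambda>" "r \<in> \<Lambda>"
      "W \<Lambda> 0 (int ?n + 1) r = {u. u @ [\<alpha>] \<in> W \<Lambda> 0 (int ?n + 2) x}"
      unfolding Ep_canonical[OF assms(1)] by auto
    have "W \<Lambda> 0 (int ?n + 2) x = W \<Lambda> k (l + 1) y"
      using *(1,3) assms n by (subst (asm) cvertex_eq_iff[OF assms(1)]) auto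
    moreover have "W \<Lambda> k l (shift_by (- k) r) = W \<Lambda> 0 (int ?n + 1) r"
      by (simp add: W_shift_by[OF assms(1)] n add.commute)
    moreover have "v = cvertex \<Lambda> k l (shift_by (- k) r)"
      using *(2,4) assms(2) n calculation(2)
      by (simp add: cvertex_eq_iff[OF assms(1)] shift_by_in_subshift[OF assms(1)])
    ultimately show "\<exists>r\<in>\<Lambda>. v = cvertex \<Lambda> k l r \<and> W \<Lambda> k l r = {u. u @ [\<alpha>] \<in> W \<Lambda> k (l + 1) y}"
      using *(4,5) shift_by_in_subshift[OF assms(1), of "- k" r] by (intro bexI[of _ "shift_by (- k) r"]) auto
  next
    assume "\<exists>r\<in>\<Lambda>. v = cvertex \<Lambda> k l r \<and> W \<Lambda> k l r = {u. u @ [\<alpha>] \<in> W \<Lambda> k (l + 1) y}"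
    then obtain r where r: "r \<in> \<Lambda>" "v = cvertex \<Lambda> k l r" "W \<Lambda> k l r = {u. u @ [\<alpha>] \<in> W \<Lambda> k (l + 1) y}"
      by blast
    let ?x = "shift_by k y" and ?r = "shift_by k r"
    have "W \<Lambda> 0 (int ?n + 1) ?r = W \<Lambda> k l r" "W \<Lambda> 0 (int ?n + 2) ?x = W \<Lambda> k (l + 1) y"
      by (simp_all add: W_shift_by[OF assms(1)] n add.commute)
    moreover have "?x \<in> \<Lambda>" "?r \<in> \<Lambda>"
      using r assms by (simp_all add: shift_by_in_subshift[OF assms(1)])
    moreover have "cvertex \<Lambda> k (l + 1) y = cvertex \<Lambda> 0 (int ?n + 2) ?x"
      "v = cvertex \<Lambda> 0 (int ?n + 1) ?r"
      using r(1,2) calculation assms n by (simp_all add: cvertex_eq_iff[OF assms(1)])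
    ultimately show "(v, cvertex \<Lambda> k (l + 1) y, \<alpha>) \<in> Ep (canonical_bisystem \<Lambda>) ?n"
      unfolding Ep_canonical[OF assms(1)] using r(3) by blast
  qed
qed

text \<open>
  Reading off a letter of \<open>y\<close> itself does not change the point, only the window. This makes the
  classes of one point at neighbouring windows the two ends of an edge.
\<close>

lemma W_shrink_left:
  assumes "y \<in> \<Lambda>" "k < l"
  shows "W \<Lambda> k l y = {u. y k # u \<in> W \<Lambda> (k - 1) l y}"
proof -
  have eq: "map y [k - 1 + 1..l - 1] = y k # map y [k + 1..l - 1]" if "k \<le> l - 1"
    using that by (simp add: upto_rec1)
  have "y k # map y [k + 1..l - 1] \<in> W \<Lambda> (k - 1) l y"
    using W_nonempty[OF assms(1), of "k - 1" l] assms(2) eq by simp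
  from W_fill_Cons[OF this] show ?thesis
    using fill_self[of "k - 1" y l] assms(2) eq by simp
qed

lemma W_shrink_right:
  assumes "y \<in> \<Lambda>" "k < l"
  shows "W \<Lambda> k l y = {u. u @ [y l] \<in> W \<Lambda> k (l + 1) y}"
proof -
  have eq: "map y [k + 1..l + 1 - 1] = map y [k + 1..l - 1] @ [y l]" if "k + 1 \<le> l"
    using that by (simp add: upto_rec2)
  have "map y [k + 1..l - 1] @ [y l] \<in> W \<Lambda> k (l + 1) y"
    using W_nonempty[OF assms(1), of k "l + 1"] assms(2) eq by simp
  from W_fill_snoc[OF this] show ?thesis
    using fill_self[of k y "l + 1"] assms(2) eq by simp
qed

text \<open>
  By the resolving properties, the class at a window and a letter leave only one choice for the
  class at the window shortened by this letter. A point that represents the larger class and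
  carries that letter has to represent this one choice.
\<close>

lemma Em_point_iff:
  assumes "subshift S \<Lambda>" "k < l" "y \<in> \<Lambda>"
  shows "(cvertex \<Lambda> (k - 1) l y, v, y k) \<in> Em (canonical_bisystem \<Lambda>) (gap k l) \<longleftrightarrow>
    v = cvertex \<Lambda> k l y"
  unfolding Em_canonical_at[OF assms] W_shrink_left[OF assms(3,2), symmetric]
  using assms by (auto simp: cvertex_eq_iff[OF assms(1)])

lemma Ep_point_iff:
  assumes "subshift S \<Lambda>" "k < l" "y \<in> \<Lambda>"
  shows "(v, cvertex \<Lambda> k (l + 1) y, y l) \<in> Ep (canonical_bisystem \<Lambda>) (gap k l) \<longleftrightarrow>
    v = cvertex \<Lambda> k l y"
  unfolding Ep_canonical_at[OF assms] W_shrink_right[OF assms(3,2), symmetric]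
  using assms by (auto simp: cvertex_eq_iff[OF assms(1)])

lemma has_labels_label_seq:
  assumes "x \<in> config_space L"
  shows "has_labels L x (label_seq L x)"
  using assms label_seq_eq unfolding config_space_def by blast

lemma config_space_at:
  assumes "x \<in> config_space L" "k < l"
  shows "vert x k l \<in> V L (gap k l)" "medge x k l \<in> Em L (gap k l)" "pedge x k l \<in> Ep L (gap k l)"
    "src_m L (medge x k l) = vert x (k - 1) l" "tgt_m L (medge x k l) = vert x k l"
    "src_p L (pedge x k l) = vert x k l" "tgt_p L (pedge x k l) = vert x k (l + 1)"
    "lab_m L (medge x k l) = label_seq L x k" "lab_p L (pedge x k l) = label_seq L x l"
proof -
  have "x (k, l) \<in> V L (gap k l) \<times> Em L (gap k l) \<times> Ep L (gap k l)"
    using assms unfolding config_space_def Z2_def by (auto dest!: PiE_mem[where x = "(k, l)"])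
  then show "vert x k l \<in> V L (gap k l)" "medge x k l \<in> Em L (gap k l)" "pedge x k l \<in> Ep L (gap k l)"
    by auto
  show "src_m L (medge x k l) = vert x (k - 1) l" "tgt_m L (medge x k l) = vert x k l"
    "src_p L (pedge x k l) = vert x k l" "tgt_p L (pedge x k l) = vert x k (l + 1)"
    using assms unfolding config_space_def by auto
  show "lab_m L (medge x k l) = label_seq L x k" "lab_p L (pedge x k l) = label_seq L x l"
    using has_labels_label_seq[OF assms(1)] assms(2) unfolding has_labels_def by auto
qed

text \<open>
  A configuration of the canonical bisystem, rebuilt from its labels and vertices.
\<close>

definition assemble :: "(int \<Rightarrow> 'a) \<Rightarrow> (int \<Rightarrow> int \<Rightarrow> 'a cvert) \<Rightarrow> ('a cvert, 'a cedge, 'a cedge) config" where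
  "assemble a v = (\<lambda>(k, l) \<in> Z2. (v k l, (v (k - 1) l, v k l, a k), (v k l, v k (l + 1), a l)))"

lemma X_space_edges:
  assumes "x \<in> X_space \<Lambda>" "k < l"
  shows "medge x k l = (vert x (k - 1) l, vert x k l, factor_map \<Lambda> x k)"
    "pedge x k l = (vert x k l, vert x k (l + 1), factor_map \<Lambda> x l)"
  using config_space_at[OF assms] by (simp_all add: prod_eq_iff)

lemma X_space_eqI:
  assumes "x \<in> X_space \<Lambda>" "z \<in> X_space \<Lambda>" "factor_map \<Lambda> x = factor_map \<Lambda> z"
    and "\<And>k l. k < l \<Longrightarrow> vert x k l = vert z k l"
  shows "x = z"
proof
  fix i
  show "x i = z i"
  proof (cases "i \<in> Z2")
    case True
    then obtain k l where i: "i = (k, l)" "k < l" by (auto simp: Z2_def)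
    have "medge x k l = medge z k l" "pedge x k l = pedge z k l" "vert x k l = vert z k l"
      using assms i(2) by (simp_all add: X_space_edges)
    then show ?thesis
      by (simp add: i(1) prod_eq_iff[of "x (k, l)"] prod_eq_iff[of "snd (x (k, l))"])
  next
    case False
    then have "x i = undefined" "z i = undefined"
      using assms(1,2) unfolding config_space_def by (auto intro: PiE_arb)
    then show ?thesis by simp
  qed
qed

text \<open>
  The points of \<open>\<Lambda>\<close> that cannot be told from \<open>x\<close> by the cylinder sets at \<open>(k, l)\<close>.
\<close>

definition approximants ::
    "(int \<Rightarrow> 'a) set \<Rightarrow> ('a cvert, 'a cedge, 'a cedge) config \<Rightarrow> int \<Rightarrow> int \<Rightarrow> (int \<Rightarrow> 'a) set" where
  "approximants \<Lambda> x k l =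
     {y \<in> \<Lambda>. vert x k l = cvertex \<Lambda> k l y \<and> (\<forall>i. k < i \<and> i < l \<longrightarrow> y i = factor_map \<Lambda> x i)}"

lemma approximants_step:
  assumes "subshift S \<Lambda>" "x \<in> X_space \<Lambda>" "k < l"
  shows "approximants \<Lambda> x (k - 1) l \<subseteq> approximants \<Lambda> x k l"
    "approximants \<Lambda> x k (l + 1) \<subseteq> approximants \<Lambda> x k l"
proof -
  note at = config_space_at(2,3)[OF assms(2,3), unfolded X_space_edges[OF assms(2,3)]]
  show "approximants \<Lambda> x (k - 1) l \<subseteq> approximants \<Lambda> x k l"
  proof
    fix y assume y: "y \<in> approximants \<Lambda> x (k - 1) l"
    then have "vert x (k - 1) l = cvertex \<Lambda> (k - 1) l y" "y k = factor_map \<Lambda> x k" "y \<in> \<Lambda>"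
      using assms(3) by (auto simp: approximants_def)
    then have "vert x k l = cvertex \<Lambda> k l y"
      using at(1) Em_point_iff[OF assms(1,3)] by metis
    then show "y \<in> approximants \<Lambda> x k l" using y by (simp add: approximants_def)
  qed
  show "approximants \<Lambda> x k (l + 1) \<subseteq> approximants \<Lambda> x k l"
  proof
    fix y assume y: "y \<in> approximants \<Lambda> x k (l + 1)"
    then have "vert x k (l + 1) = cvertex \<Lambda> k (l + 1) y" "y l = factor_map \<Lambda> x l" "y \<in> \<Lambda>"
      using assms(3) by (auto simp: approximants_def)
    then have "vert x k l = cvertex \<Lambda> k l y"
      using at(2) Ep_point_iff[OF assms(1,3)] by metis
    then show "y \<in> approximants \<Lambda> x k l" using y by (simp add: approximants_def)
  qed
qed

text \<open>
  Agreement at one window implies agreement at all smaller ones, because the classes at these are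
  reached by following edges whose labels are letters of the approximant.
\<close>

lemma approximants_mono:
  assumes "subshift S \<Lambda>" "x \<in> X_space \<Lambda>" "p \<le> k" "k < l" "l \<le> q"
  shows "approximants \<Lambda> x p q \<subseteq> approximants \<Lambda> x k l"
proof -
  have "approximants \<Lambda> x p q \<subseteq> approximants \<Lambda> x k q"
    using assms(3)
  proof (induction rule: int_le_induct)
    case (step i)
    then show ?case using approximants_step(1)[OF assms(1,2), of i q] assms(4,5) by auto
  qed simp
  also have "\<dots> \<subseteq> approximants \<Lambda> x k l"
    using assms(5)
  proof (induction rule: int_ge_induct)
    case (step i)
    then show ?case using approximants_step(2)[OF assms(1,2), of k i] assms(4) by auto
  qed simp
  finally show ?thesis .
qed

text \<open>
  A representative of the class at \<open>(k, l)\<close> need not have the letters of \<open>x\<close>, but these form a word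
  that may be filled into its gap: following the minus-edges from \<open>(k, l)\<close> to \<open>(l - 1, l)\<close> splits off
  one letter at a time and ends at the empty gap.
\<close>

lemma approximants_nonempty:
  assumes "subshift S \<Lambda>" "x \<in> X_space \<Lambda>" "k < l"
  shows "approximants \<Lambda> x k l \<noteq> {}"
proof -
  let ?a = "factor_map \<Lambda> x"
  have rep: "\<exists>y\<in>\<Lambda>. vert x k l = cvertex \<Lambda> k l y" if "k < l" for k
    using config_space_at(1)[OF assms(2) that] V_canonical_at[OF assms(1) that] by blast
  have word: "map ?a [k + 1..l - 1] \<in> W \<Lambda> k l y"
    if "k \<le> l - 1" "y \<in> \<Lambda>" "vert x k l = cvertex \<Lambda> k l y" for k y
    using that
  proof (induction arbitrary: y rule: int_le_induct)
    case base
    then show ?case using W_nonempty[of y \<Lambda> "l - 1" l] by simp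
  next
    case (step k)
    have kl: "k < l" using step.hyps by simp
    have "(cvertex \<Lambda> (k - 1) l y, vert x k l, ?a k) \<in> Em (canonical_bisystem \<Lambda>) (gap k l)"
      using config_space_at(2)[OF assms(2) kl] by (simp add: X_space_edges[OF assms(2) kl] step.prems)
    then obtain r where "r \<in> \<Lambda>" "vert x k l = cvertex \<Lambda> k l r"
      "W \<Lambda> k l r = {u. ?a k # u \<in> W \<Lambda> (k - 1) l y}"
      using Em_canonical_at[OF assms(1) kl step.prems(1)] by blast
    then have "?a k # map ?a [k + 1..l - 1] \<in> W \<Lambda> (k - 1) l y"
      using step.IH by blast
    moreover have "[k - 1 + 1..l - 1] = k # [k + 1..l - 1]"
      using kl by (simp add: upto_rec1)
    ultimately show ?case by simp
  qed
  obtain y where y: "y \<in> \<Lambda>" "vert x k l = cvertex \<Lambda> k l y" using rep[OF assms(3)] by blast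
  let ?y = "fill k (map ?a [k + 1..l - 1]) y"
  have "?y \<in> \<Lambda>" using word[OF _ y] assms(3) by (simp add: W_def)
  moreover have "W \<Lambda> k l ?y = W \<Lambda> k l y"
  proof -
    have "fill k u ?y = fill k u y" if "length u = gap k l" for u
      using that assms(3) by (auto simp: fill_def gap_def fun_eq_iff)
    then show ?thesis by (auto simp: W_def)
  qed
  moreover have "?y i = ?a i" if "k < i" "i < l" for i
    using that by (simp add: fill_def)
  ultimately have "?y \<in> approximants \<Lambda> x k l"
    using y assms(1,3) by (simp add: approximants_def cvertex_eq_iff[OF assms(1)])
  then show ?thesis by blast
qed

text \<open>
  All conditions on a configuration involve only two neighbouring windows, so they hold as soon
  as they hold for the points that approximate the data.
\<close>

lemma assemble_approximated:
  assumes "subshift S \<Lambda>"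
    and "\<And>p q. p < q \<Longrightarrow> \<exists>y\<in>\<Lambda>. (\<forall>i. p < i \<and> i < q \<longrightarrow> y i = a i) \<and>
        (\<forall>k l. p \<le> k \<and> k < l \<and> l \<le> q \<longrightarrow> v k l = cvertex \<Lambda> k l y)"
  shows "assemble a v \<in> X_space \<Lambda>" "factor_map \<Lambda> (assemble a v) = a"
    "k < l \<Longrightarrow> vert (assemble a v) k l = v k l"
proof -
  let ?L = "canonical_bisystem \<Lambda>"
  have labels: "has_labels ?L (assemble a v) a"
    by (simp add: has_labels_def assemble_def Z2_def)
  have "v k l \<in> V ?L (gap k l) \<and> (v (k - 1) l, v k l, a k) \<in> Em ?L (gap k l) \<and>
      (v k l, v k (l + 1), a l) \<in> Ep ?L (gap k l)" if "k < l" for k l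
  proof -
    have "k - 1 < l + 1" using that by simp
    from assms(2)[OF this] obtain y where y: "y \<in> \<Lambda>" "\<And>i. k - 1 < i \<and> i < l + 1 \<Longrightarrow> y i = a i"
      "\<And>k' l'. k - 1 \<le> k' \<and> k' < l' \<and> l' \<le> l + 1 \<Longrightarrow> v k' l' = cvertex \<Lambda> k' l' y"
      by blast
    have "v k l = cvertex \<Lambda> k l y" "v (k - 1) l = cvertex \<Lambda> (k - 1) l y"
      "v k (l + 1) = cvertex \<Lambda> k (l + 1) y" "a k = y k" "a l = y l"
      using that y(2)[of k] y(2)[of l] by (auto intro: y(3))
    then show ?thesis
      using y(1) that V_canonical_at[OF assms(1) that] Em_point_iff[OF assms(1) that y(1)]
        Ep_point_iff[OF assms(1) that y(1)] by auto
  qed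
  then show "assemble a v \<in> X_space \<Lambda>"
    using labels unfolding config_space_def by (auto simp: assemble_def Z2_def)
  show "factor_map \<Lambda> (assemble a v) = a" by (rule label_seq_eq[OF labels])
  show "k < l \<Longrightarrow> vert (assemble a v) k l = v k l"
    by (simp add: assemble_def Z2_def)
qed

lemma config_shift_X_space:
  assumes "x \<in> X_space \<Lambda>"
  shows "config_shift x \<in> X_space \<Lambda>" "factor_map \<Lambda> (config_shift x) = shift (factor_map \<Lambda> x)"
proof -
  let ?L = "canonical_bisystem \<Lambda>"
  have sh: "config_shift x (k, l) = x (k + 1, l + 1)" if "k < l" for k l
    using that by (simp add: config_shift_def Z2_def)
  have g: "gap (k + 1) (l + 1) = gap k l" for k l by (simp add: gap_def)
  have labels: "has_labels ?L (config_shift x) (shift (factor_map \<Lambda> x))"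
    using config_space_at(8,9)[OF assms] by (simp add: has_labels_def sh shift_by_def)
  show "config_shift x \<in> X_space \<Lambda>"
    unfolding config_space_def
  proof (intro CollectI conjI allI impI PiE_I)
    show "\<exists>a. has_labels ?L (config_shift x) a" using labels by blast
  next
    fix i assume "i \<in> Z2"
    then obtain k l where i: "i = (k, l)" "k < l" by (auto simp: Z2_def)
    show "config_shift x i \<in> (case i of (k, l) \<Rightarrow> V ?L (gap k l) \<times> Em ?L (gap k l) \<times> Ep ?L (gap k l))"
      using config_space_at(1-3)[OF assms, of "k + 1" "l + 1"] i by (simp add: sh g mem_Times_iff)
  next
    fix i :: "int \<times> int" assume "i \<notin> Z2"
    then show "config_shift x i = undefined" by (simp add: config_shift_def)
  next
    fix k l :: int assume "k < l"
    then show "src_m ?L (medge (config_shift x) k l) = vert (config_shift x) (k - 1) l"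
      "tgt_m ?L (medge (config_shift x) k l) = vert (config_shift x) k l"
      "src_p ?L (pedge (config_shift x) k l) = vert (config_shift x) k l"
      "tgt_p ?L (pedge (config_shift x) k l) = vert (config_shift x) k (l + 1)"
      using config_space_at(4-7)[OF assms, of "k + 1" "l + 1"] by (simp_all add: sh)
  qed
  show "factor_map \<Lambda> (config_shift x) = shift (factor_map \<Lambda> x)"
    by (rule label_seq_eq[OF labels])
qed

lemma approximants_shift:
  assumes "subshift S \<Lambda>" "x \<in> X_space \<Lambda>" "k < l" "y \<in> approximants \<Lambda> x (k + 1) (l + 1)"
  shows "shift y \<in> approximants \<Lambda> (config_shift x) k l"
proof -
  have y: "y \<in> \<Lambda>" "vert x (k + 1) (l + 1) = cvertex \<Lambda> (k + 1) (l + 1) y"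
    "\<And>i. k + 1 < i \<Longrightarrow> i < l + 1 \<Longrightarrow> y i = factor_map \<Lambda> x i"
    using assms(4) by (auto simp: approximants_def)
  have "shift y \<in> \<Lambda>" using y(1) by (simp add: shift_by_in_subshift[OF assms(1)])
  moreover have "cvertex \<Lambda> (k + 1) (l + 1) y = cvertex \<Lambda> k l (shift y)"
    using y(1) \<open>shift y \<in> \<Lambda>\<close> assms(3) by (simp add: cvertex_eq_iff[OF assms(1)] W_shift_by[OF assms(1)])
  moreover have "vert (config_shift x) k l = vert x (k + 1) (l + 1)"
    using assms(3) by (simp add: config_shift_def Z2_def)
  moreover have "shift y i = factor_map \<Lambda> (config_shift x) i" if "k < i" "i < l" for i
    using y(3)[of "i + 1"] that by (simp add: config_shift_X_space[OF assms(2)] shift_by_def)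
  ultimately show ?thesis using y(2) by (simp add: approximants_def)
qed

text \<open>
  With this lemma an equation between maps of configurations follows from the same equation for
  points of the subshift.
\<close>

lemma X_space_eq_by_approximants:
  assumes "x \<in> X_space \<Lambda>" "z \<in> X_space \<Lambda>"
    and "\<And>k l. k < l \<Longrightarrow> approximants \<Lambda> x k l \<inter> approximants \<Lambda> z k l \<noteq> {}"
  shows "x = z"
proof (rule X_space_eqI[OF assms(1,2)])
  show "factor_map \<Lambda> x = factor_map \<Lambda> z"
  proof
    fix i :: int
    obtain y where "y \<in> approximants \<Lambda> x (i - 1) (i + 1)" "y \<in> approximants \<Lambda> z (i - 1) (i + 1)"
      using assms(3)[of "i - 1" "i + 1"] by auto
    then show "factor_map \<Lambda> x i = factor_map \<Lambda> z i"
      by (simp add: approximants_def)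
  qed
  show "vert x k l = vert z k l" if "k < l" for k l
    using assms(3)[OF that] by (auto simp: approximants_def)
qed

section \<open>Sliding block codes\<close>

lemma topspace_full_shift: "topspace (full_shift_topology S) = UNIV \<rightarrow>\<^sub>E S"
  by (simp add: full_shift_topology_def)

lemma full_shift_neighbourhood:
  assumes "openin (full_shift_topology S) U" "x \<in> U"
  shows "\<exists>n::int. 0 \<le> n \<and> (\<forall>z\<in>UNIV \<rightarrow>\<^sub>E S. (\<forall>i. \<bar>i\<bar> \<le> n \<longrightarrow> z i = x i) \<longrightarrow> z \<in> U)"
proof -
  obtain X where X: "x \<in> (\<Pi>\<^sub>E i\<in>UNIV. X i)" "finite {i. X i \<noteq> S}" "(\<Pi>\<^sub>E i\<in>UNIV. X i) \<subseteq> U"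
    using product_topology_open_contains_basis[OF assms(1)[unfolded full_shift_topology_def] assms(2)] by auto
  define n where "n = Max (insert 0 (abs ` {i. X i \<noteq> S}))"
  have n: "0 \<le> n" "\<And>i. X i \<noteq> S \<Longrightarrow> \<bar>i\<bar> \<le> n"
    using X(2) by (auto simp: n_def)
  have "z \<in> U" if z: "z \<in> UNIV \<rightarrow>\<^sub>E S" "\<And>i. \<bar>i\<bar> \<le> n \<Longrightarrow> z i = x i" for z
  proof -
    have "z i \<in> X i" for i
      using z n(2)[of i] X(1) by (cases "X i = S") (auto simp: PiE_def Pi_def)
    then show ?thesis using X(3) by (auto simp: PiE_def)
  qed
  then show ?thesis using n(1) by blast
qed

lemma full_shift_cylinder_open:
  assumes "finite I"
  shows "openin (full_shift_topology S) {z \<in> UNIV \<rightarrow>\<^sub>E S. \<forall>i\<in>I. z i = y i}"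
proof -
  have "openin (full_shift_topology S) (\<Pi>\<^sub>E i\<in>UNIV. if i \<in> I then S \<inter> {y i} else S)"
    unfolding full_shift_topology_def
    by (rule product_topology_basis) (auto intro: rev_finite_subset[OF assms])
  also have "(\<Pi>\<^sub>E i\<in>UNIV. if i \<in> I then S \<inter> {y i} else S) = {z \<in> UNIV \<rightarrow>\<^sub>E S. \<forall>i\<in>I. z i = y i}"
    by (auto simp: PiE_def Pi_def split: if_splits)
  finally show ?thesis .
qed

lemma subshift_subset:
  assumes "subshift S \<Lambda>"
  shows "\<Lambda> \<subseteq> UNIV \<rightarrow>\<^sub>E S"
  using assms closedin_subset topspace_full_shift unfolding subshift_def by metis

lemma topspace_subshift:
  assumes "subshift S \<Lambda>"
  shows "topspace (subshift_topology S \<Lambda>) = \<Lambda>"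
  using subshift_subset[OF assms] by (auto simp: subshift_topology_def topspace_full_shift)

lemma subshift_limit:
  assumes "subshift S \<Lambda>" "\<And>n. \<exists>y\<in>\<Lambda>. \<forall>i. \<bar>i\<bar> \<le> n \<longrightarrow> y i = a i"
  shows "a \<in> \<Lambda>"
proof (rule ccontr)
  assume "a \<notin> \<Lambda>"
  have "a i \<in> S" for i
  proof -
    obtain y where "y \<in> \<Lambda>" "y i = a i" using assms(2)[of "\<bar>i\<bar>"] by auto
    then show ?thesis using subshift_subset[OF assms(1)] by (metis PiE_mem UNIV_I subsetD)
  qed
  then have a: "a \<in> (UNIV \<rightarrow>\<^sub>E S) - \<Lambda>" using \<open>a \<notin> \<Lambda>\<close> by (simp add: PiE_def Pi_def)
  have op: "openin (full_shift_topology S) ((UNIV \<rightarrow>\<^sub>E S) - \<Lambda>)"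
    using assms(1) by (simp add: subshift_def closedin_def topspace_full_shift)
  obtain n where "0 \<le> n" and n:
    "\<And>z. \<lbrakk>z \<in> UNIV \<rightarrow>\<^sub>E S; \<And>i. \<bar>i\<bar> \<le> n \<Longrightarrow> z i = a i\<rbrakk> \<Longrightarrow> z \<in> (UNIV \<rightarrow>\<^sub>E S) - \<Lambda>"
    using full_shift_neighbourhood[OF op a] by blast
  obtain y where "y \<in> \<Lambda>" "\<forall>i. \<bar>i\<bar> \<le> n \<longrightarrow> y i = a i" using assms(2) by blast
  then show False using n[of y] subshift_subset[OF assms(1)] by blast
qed

definition sliding_block_code :: "int \<Rightarrow> (int \<Rightarrow> 'a) set \<Rightarrow> ((int \<Rightarrow> 'a) \<Rightarrow> (int \<Rightarrow> 'b)) \<Rightarrow> bool" where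
  "sliding_block_code n \<Lambda> f \<longleftrightarrow> (\<forall>y\<in>\<Lambda>. \<forall>z\<in>\<Lambda>. \<forall>i.
     (\<forall>j. i - n \<le> j \<and> j \<le> i + n \<longrightarrow> y j = z j) \<longrightarrow> f y i = f z i)"

lemma sliding_block_codeD:
  assumes "sliding_block_code n \<Lambda> f" "y \<in> \<Lambda>" "z \<in> \<Lambda>"
    and "\<And>j. i - n \<le> j \<Longrightarrow> j \<le> i + n \<Longrightarrow> y j = z j"
  shows "f y i = f z i"
  using assms unfolding sliding_block_code_def by blast

lemma sliding_block_code_mono:
  assumes "sliding_block_code n \<Lambda> f" "n \<le> m"
  shows "sliding_block_code m \<Lambda> f"
  unfolding sliding_block_code_def using assms(2) by (auto intro!: sliding_block_codeD[OF assms(1)])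

lemma commutes_with_shift_by:
  assumes "subshift S \<Lambda>" "\<And>y. y \<in> \<Lambda> \<Longrightarrow> f (shift y) = shift (f y)" "y \<in> \<Lambda>"
  shows "f (shift_by i y) = shift_by i (f y)"
proof (induction i rule: int_induct[where k = 0])
  case (step1 i)
  have "f (shift_by (i + 1) y) = f (shift (shift_by i y))" by (simp add: add.commute)
  also have "\<dots> = shift (f (shift_by i y))"
    by (rule assms(2)) (simp add: shift_by_in_subshift[OF assms(1)] assms(3))
  finally show ?case by (simp add: step1 add.commute)
next
  case (step2 i)
  have "shift (f (shift_by (i - 1) y)) = f (shift (shift_by (i - 1) y))"
    by (rule assms(2)[symmetric]) (simp add: shift_by_in_subshift[OF assms(1)] assms(3))
  also have "\<dots> = shift_by i (f y)" by (simp add: step2)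
  finally have "shift_by (-1) (shift (f (shift_by (i - 1) y))) = shift_by (-1) (shift_by i (f y))"
    by simp
  then show ?case by simp
qed simp

text \<open>
  The letter of \<open>f y\<close> at \<open>0\<close> depends on finitely many letters of \<open>y\<close>, by continuity; compactness
  makes their number uniform in \<open>y\<close>, and equivariance moves the bound to every other place.
\<close>

theorem curtis_hedlund_lyndon:
  assumes sub: "subshift S \<Lambda>"
    and cont: "continuous_map (subshift_topology S \<Lambda>) (full_shift_topology T) f"
    and comm: "\<And>y. y \<in> \<Lambda> \<Longrightarrow> f (shift y) = shift (f y)"
  obtains n where "0 \<le> n" "sliding_block_code n \<Lambda> f"
proof -
  have \<Lambda>: "\<Lambda> \<subseteq> UNIV \<rightarrow>\<^sub>E S" by (rule subshift_subset[OF sub])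
  have "continuous_map (full_shift_topology T) (discrete_topology T) (\<lambda>z. z 0)"
    unfolding full_shift_topology_def by (rule continuous_map_product_projection) simp
  then have cont0: "continuous_map (subshift_topology S \<Lambda>) (discrete_topology T) (\<lambda>z. f z 0)"
    using continuous_map_compose[OF cont] by (fastforce simp: comp_def)
  note top = topspace_subshift[OF sub]
  have "\<exists>n\<ge>0. \<forall>z\<in>\<Lambda>. (\<forall>i. \<bar>i\<bar> \<le> n \<longrightarrow> z i = y i) \<longrightarrow> f z 0 = f y 0" if y: "y \<in> \<Lambda>" for y
  proof -
    have "f y 0 \<in> T" using continuous_map_funspace[OF cont0] y top by auto
    then have "openin (subshift_topology S \<Lambda>) {z \<in> \<Lambda>. f z 0 \<in> {f y 0}}"
      using openin_continuous_map_preimage[OF cont0, of "{f y 0}"] top by simp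
    then obtain U where U: "openin (full_shift_topology S) U" "{z \<in> \<Lambda>. f z 0 \<in> {f y 0}} = U \<inter> \<Lambda>"
      unfolding subshift_topology_def openin_subtopology by blast
    then obtain n where "0 \<le> n"
      "\<And>z. \<lbrakk>z \<in> UNIV \<rightarrow>\<^sub>E S; \<And>i. \<bar>i\<bar> \<le> n \<Longrightarrow> z i = y i\<rbrakk> \<Longrightarrow> z \<in> U"
      using full_shift_neighbourhood[OF U(1), of y] y by blast
    then show ?thesis using U(2) \<Lambda> by (intro exI[of _ n]) blast
  qed
  then obtain n where n: "\<And>y. y \<in> \<Lambda> \<Longrightarrow> 0 \<le> n y"
    "\<And>y z. \<lbrakk>y \<in> \<Lambda>; z \<in> \<Lambda>; \<And>i. \<bar>i\<bar> \<le> n y \<Longrightarrow> z i = y i\<rbrakk> \<Longrightarrow> f z 0 = f y 0"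
    by metis
  define C where "C y = {z \<in> UNIV \<rightarrow>\<^sub>E S. \<forall>i\<in>{- n y..n y}. z i = y i}" for y
  have "compactin (full_shift_topology S) \<Lambda>"
  proof (rule closedin_compact_space)
    show "compact_space (full_shift_topology S)"
      using sub by (simp add: full_shift_topology_def compact_space_product_topology
          compact_space_discrete_topology subshift_def)
    show "closedin (full_shift_topology S) \<Lambda>" using sub by (simp add: subshift_def)
  qed
  moreover have "openin (full_shift_topology S) U" if "U \<in> C ` \<Lambda>" for U
    using that full_shift_cylinder_open[of "{- n y..n y}" for y] unfolding C_def by auto
  moreover have "\<Lambda> \<subseteq> \<Union>(C ` \<Lambda>)" using \<Lambda> by (auto simp: C_def)
  ultimately have "\<exists>\<F>. finite \<F> \<and> \<F> \<subseteq> C ` \<Lambda> \<and> \<Lambda> \<subseteq> \<Union>\<F>"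
    by (rule compactinD)
  then obtain Y where Y: "finite Y" "Y \<subseteq> \<Lambda>" "\<Lambda> \<subseteq> \<Union>(C ` Y)"
    by (metis finite_subset_image)
  define m where "m = Max (insert 0 (n ` Y))"
  have m: "0 \<le> m" "\<And>y. y \<in> Y \<Longrightarrow> n y \<le> m" using Y(1) by (auto simp: m_def)
  have at_0: "f y 0 = f z 0" if yz: "y \<in> \<Lambda>" "z \<in> \<Lambda>" "\<And>i. \<bar>i\<bar> \<le> m \<Longrightarrow> y i = z i" for y z
  proof -
    obtain r where r: "r \<in> Y" "y \<in> C r" using Y(3) yz(1) by blast
    have "y i = r i" "z i = r i" if "\<bar>i\<bar> \<le> n r" for i
      using r m(2)[OF r(1)] that yz(3)[of i] by (auto simp: C_def abs_le_iff)
    then show ?thesis using n(2)[of r y] n(2)[of r z] r(1) Y(2) yz(1,2) by auto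
  qed
  have "f y i = f z i" if "y \<in> \<Lambda>" "z \<in> \<Lambda>" "\<And>j. i - m \<le> j \<Longrightarrow> j \<le> i + m \<Longrightarrow> y j = z j" for y z i
  proof -
    have "shift_by i y \<in> \<Lambda>" "shift_by i z \<in> \<Lambda>"
      using that(1,2) by (simp_all add: shift_by_in_subshift[OF sub])
    then have "f (shift_by i y) 0 = f (shift_by i z) 0"
      by (rule at_0) (auto simp: shift_by_def intro!: that(3))
    then show ?thesis
      using that by (simp add: commutes_with_shift_by[where f = f, OF sub comm]) (simp add: shift_by_def)
  qed
  then show ?thesis using that[OF m(1)] unfolding sliding_block_code_def by blast
qed

text \<open>
  The label sequence is a limit of approximants, and \<open>\<Lambda>\<close> is closed.
\<close>

lemma factor_map_in_subshift:
  assumes "subshift S \<Lambda>" "x \<in> X_space \<Lambda>"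
  shows "factor_map \<Lambda> x \<in> \<Lambda>"
proof (rule subshift_limit[OF assms(1)])
  fix n :: int
  have "- \<bar>n\<bar> - 1 < \<bar>n\<bar> + 1" by linarith
  from approximants_nonempty[OF assms this]
  obtain y where "y \<in> approximants \<Lambda> x (- \<bar>n\<bar> - 1) (\<bar>n\<bar> + 1)" by blast
  then show "\<exists>y\<in>\<Lambda>. \<forall>i. \<bar>i\<bar> \<le> n \<longrightarrow> y i = factor_map \<Lambda> x i"
    by (intro bexI[of _ y]) (auto simp: approximants_def abs_if split: if_splits)
qed

section \<open>The topologies of configurations and of the equivalence relation\<close>

text \<open>
  The plus-edges along the row \<open>p\<close> form a path to the vertex at \<open>(p, q)\<close>, which shows that the
  cylinder sets around configurations are among the generators of the topology.
\<close>

lemma label_word_in_P_words: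
  assumes "x \<in> config_space L" "p < q"
  shows "map (label_seq L x) [p + 1..q - 1] \<in> P_words L (gap p q) (vert x p q)"
proof -
  let ?e = "\<lambda>i. pedge x p (p + 1 + int i)"
  let ?fs = "map ?e [0..<gap p q]"
  have e: "?e i \<in> Ep L i" "src_p L (?e i) = vert x p (p + 1 + int i)"
    "tgt_p L (?e i) = vert x p (p + 1 + int (Suc i))" "lab_p L (?e i) = label_seq L x (p + 1 + int i)" for i
    using config_space_at[OF assms(1), of p "p + 1 + int i"] by (simp_all add: gap_def add.commute add.left_commute)
  have "map (label_seq L x) [p + 1..q - 1] = map (lab_p L) ?fs"
    by (rule nth_equalityI) (simp_all add: gap_def e)
  moreover have "tgt_p L (last ?fs) = vert x p q" if nonempty: "?fs \<noteq> []"
  proof -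
    obtain m where m: "gap p q = Suc m" using nonempty by (cases "gap p q") auto
    then have "q = p + 1 + int (Suc m)" by (simp add: gap_def)
    then show ?thesis using m e(3)[of m] by simp
  qed
  moreover have "src_p L (?e (Suc i)) = tgt_p L (?e i)" for i by (simp only: e)
  ultimately show ?thesis
    unfolding P_words_def using e(1) by (intro CollectI exI[of _ ?fs]) (auto simp del: of_nat_Suc)
qed

lemma openin_config_cylinder:
  assumes "x \<in> config_space L" "p < q"
  shows "openin (config_topology L) {z \<in> config_space L. vert z p q = vert x p q \<and>
    (\<forall>i. p < i \<and> i < q \<longrightarrow> label_seq L z i = label_seq L x i)}"
proof -
  have "{z \<in> config_space L. vert z p q = vert x p q \<and>
      (\<forall>i. p < i \<and> i < q \<longrightarrow> label_seq L z i = label_seq L x i)} =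
    cyl L p q (map (label_seq L x) [p + 1..q - 1]) (vert x p q)"
    by (auto simp: cyl_def)
  moreover have "openin (config_topology L) (cyl L p q (map (label_seq L x) [p + 1..q - 1]) (vert x p q))"
    unfolding config_topology_def
    using label_word_in_P_words[OF assms] config_space_at(1)[OF assms] assms(2)
    by (intro topology_generated_by_Basis) blast
  ultimately show ?thesis by simp
qed

lemma R_level_iff:
  "(x, z) \<in> R_level L p q \<longleftrightarrow>
    x \<in> config_space L \<and> z \<in> config_space L \<and> (\<forall>k l. k \<le> p \<and> q \<le> l \<longrightarrow> x (k, l) = z (k, l))"
proof -
  have "square p q x = square p q z \<longleftrightarrow> (\<forall>k l. k \<le> p \<and> q \<le> l \<longrightarrow> x (k, l) = z (k, l))"
    unfolding square_def restrict_def fun_eq_iff by auto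
  then show ?thesis unfolding R_level_def by blast
qed

text \<open>
  The minus-edge at \<open>(k, l)\<close> carries the label at \<open>k\<close> and the plus-edge the label at \<open>l\<close>, so the
  quadrant sees exactly the labels outside of the open interval from \<open>p\<close> to \<open>q\<close>.
\<close>

lemma R_level_canonical_iff:
  assumes "p < q"
  shows "(x, z) \<in> R_level (canonical_bisystem \<Lambda>) p q \<longleftrightarrow> x \<in> X_space \<Lambda> \<and> z \<in> X_space \<Lambda> \<and>
    (\<forall>k l. k \<le> p \<and> q \<le> l \<longrightarrow> vert x k l = vert z k l) \<and>
    (\<forall>i. i \<le> p \<or> q \<le> i \<longrightarrow> factor_map \<Lambda> x i = factor_map \<Lambda> z i)"
proof -
  have "(\<forall>k l. k \<le> p \<and> q \<le> l \<longrightarrow> x (k, l) = z (k, l)) \<longleftrightarrow>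
    (\<forall>k l. k \<le> p \<and> q \<le> l \<longrightarrow> vert x k l = vert z k l) \<and>
    (\<forall>i. i \<le> p \<or> q \<le> i \<longrightarrow> factor_map \<Lambda> x i = factor_map \<Lambda> z i)" (is "?L \<longleftrightarrow> ?V \<and> ?A")
    if x: "x \<in> X_space \<Lambda>" and z: "z \<in> X_space \<Lambda>"
  proof (intro iffI conjI)
    assume ?L
    then show ?V by simp
    show ?A
    proof (intro allI impI)
      fix i assume "i \<le> p \<or> q \<le> i"
      then show "factor_map \<Lambda> x i = factor_map \<Lambda> z i"
      proof
        assume i: "i \<le> p"
        then have "medge x i q = medge z i q" using \<open>?L\<close> by simp
        then show ?thesis using i assms by (simp add: X_space_edges[OF x] X_space_edges[OF z])
      next
        assume i: "q \<le> i"
        then have "pedge x p i = pedge z p i" using \<open>?L\<close> by simp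
        then show ?thesis using i assms by (simp add: X_space_edges[OF x] X_space_edges[OF z])
      qed
    qed
  next
    assume *: "?V \<and> ?A"
    show ?L
    proof (intro allI impI)
      fix k l assume kl: "k \<le> p \<and> q \<le> l"
      then have "k < l" using assms by simp
      have "vert x k l = vert z k l" "medge x k l = medge z k l" "pedge x k l = pedge z k l"
        using * kl unfolding X_space_edges[OF x \<open>k < l\<close>] X_space_edges[OF z \<open>k < l\<close>] by auto
      then show "x (k, l) = z (k, l)"
        by (simp add: prod_eq_iff[of "x (k, l)"] prod_eq_iff[of "snd (x (k, l))"])
    qed
  qed
  then show ?thesis unfolding R_level_iff by blast
qed

text \<open>
  On a single level the topology is a subspace topology of the product, so continuity there
  comes from continuity of \<open>h\<close>. The inductive limit topology only needs that every level is
  mapped into some level.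
\<close>

lemma continuous_map_R_topology:
  assumes cont: "continuous_map (config_topology L) (config_topology L') h"
    and level: "\<And>p q. p < q \<Longrightarrow> \<exists>p' q'. p' < q' \<and> map_prod h h ` R_level L p q \<subseteq> R_level L' p' q'"
  shows "continuous_map (R_topology L) (R_topology L') (map_prod h h)"
proof -
  have RR: "map_prod h h ` R_rel L \<subseteq> R_rel L'"
    using level unfolding R_rel_def Z2_def by fast
  have "openin (R_topology L) {r \<in> R_rel L. map_prod h h r \<in> U}" if U: "openin (R_topology L') U" for U
    unfolding openin_R_topology
  proof (intro conjI ballI, simp, clarsimp simp: Z2_def)
    fix p q :: int assume "p < q"
    then obtain p' q' where pq: "p' < q'" "map_prod h h ` R_level L p q \<subseteq> R_level L' p' q'"
      using level by blast
    have top: "topspace (R_level_topology L p q) = R_level L p q"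
      by (auto simp: R_level_topology_def topspace_config_topology R_level_def)
    have "continuous_map (prod_topology (config_topology L) (config_topology L))
        (prod_topology (config_topology L') (config_topology L')) (map_prod h h)"
      using cont by (simp add: map_prod_def continuous_map_prod_top)
    then have "continuous_map (R_level_topology L p q) (R_level_topology L' p' q') (map_prod h h)"
      using pq(2) top unfolding R_level_topology_def
      by (intro continuous_map_into_subtopology continuous_map_from_subtopology) auto
    moreover have "openin (R_level_topology L' p' q') (U \<inter> R_level L' p' q')"
      using U pq(1) unfolding openin_R_topology Z2_def by blast
    ultimately have "openin (R_level_topology L p q)
        {r \<in> R_level L p q. map_prod h h r \<in> U \<inter> R_level L' p' q'}"
      using openin_continuous_map_preimage top by fastforce
    also have "{r \<in> R_level L p q. map_prod h h r \<in> U \<inter> R_level L' p' q'} =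
        {r \<in> R_rel L. map_prod h h r \<in> U} \<inter> R_level L p q"
      using pq(2) \<open>p < q\<close> unfolding R_rel_def Z2_def by blast
    finally show "openin (R_level_topology L p q) ({r \<in> R_rel L. map_prod h h r \<in> U} \<inter> R_level L p q)" .
  qed
  then show ?thesis
    using RR by (auto simp: continuous_map_def topspace_R_topology)
qed


section \<open>The lift of a conjugacy to configurations\<close>

text \<open>
  The assumptions are symmetric under exchanging \<open>f\<close> and \<open>g\<close> (the shift equation for \<open>g\<close> follows), so
  whatever holds for the lift of \<open>f\<close> also holds for that of \<open>g\<close>.
\<close>

locale coded_conjugacy =
  fixes S1 :: "'a set" and \<Lambda>1 :: "(int \<Rightarrow> 'a) set"
    and S2 :: "'b set" and \<Lambda>2 :: "(int \<Rightarrow> 'b) set"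
    and f :: "(int \<Rightarrow> 'a) \<Rightarrow> (int \<Rightarrow> 'b)" and g :: "(int \<Rightarrow> 'b) \<Rightarrow> (int \<Rightarrow> 'a)" and N :: int
  assumes sub1: "subshift S1 \<Lambda>1" and sub2: "subshift S2 \<Lambda>2"
    and f_in: "y \<in> \<Lambda>1 \<Longrightarrow> f y \<in> \<Lambda>2" and g_in: "z \<in> \<Lambda>2 \<Longrightarrow> g z \<in> \<Lambda>1"
    and gf: "y \<in> \<Lambda>1 \<Longrightarrow> g (f y) = y" and fg: "z \<in> \<Lambda>2 \<Longrightarrow> f (g z) = z"
    and f_shift: "y \<in> \<Lambda>1 \<Longrightarrow> f (shift y) = shift (f y)"
    and N_nonneg: "0 \<le> N"
    and f_code: "sliding_block_code N \<Lambda>1 f" and g_code: "sliding_block_code N \<Lambda>2 g"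
begin

lemma inverse_conjugacy: "coded_conjugacy S2 \<Lambda>2 S1 \<Lambda>1 g f N"
proof
  fix z assume z: "z \<in> \<Lambda>2"
  have "shift (g z) \<in> \<Lambda>1" using g_in[OF z] by (simp add: shift_by_in_subshift[OF sub1])
  then have "shift (g z) = g (f (shift (g z)))" by (simp add: gf)
  also have "\<dots> = g (shift z)" using z by (simp add: f_shift g_in fg)
  finally show "g (shift z) = shift (g z)" by simp
qed (use sub1 sub2 f_in g_in gf fg N_nonneg f_code g_code in auto)

text \<open>
  Let \<open>w\<close> fit into the gap of \<open>f y\<close>, and let \<open>t\<close> be the preimage of the filled point. It differs from
  \<open>y\<close> only between \<open>k - N\<close> and \<open>l + N\<close>, so its part \<open>u\<close> in the larger window fits into \<open>y\<close>, hence into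
  \<open>y'\<close>. Filling \<open>u\<close> into \<open>y'\<close> gives a point \<open>t'\<close>, whose image is \<open>f y'\<close> with \<open>w\<close> filled in: near the gap \<open>t'\<close> is
  \<open>t\<close>, and away from it \<open>t'\<close> is \<open>y'\<close>. The margin \<open>3 N\<close> makes these two regions overlap by \<open>2 N\<close> on
  either side, so that every window of radius \<open>N\<close> lies in one of them.

  The assumptions compare letters only up to \<open>N\<close> places inside of the gap, because approximants
  of two equivalent configurations may differ further inside.
\<close>

lemma central_class_local:
  assumes y: "y \<in> \<Lambda>1" "y' \<in> \<Lambda>1" and kl: "k < l"
    and W: "W \<Lambda>1 (k - 3 * N) (l + 3 * N) y = W \<Lambda>1 (k - 3 * N) (l + 3 * N) y'"
    and left: "\<And>i. k - 3 * N < i \<Longrightarrow> i \<le> k + N \<Longrightarrow> y i = y' i"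
    and right: "\<And>i. l - N \<le> i \<Longrightarrow> i < l + 3 * N \<Longrightarrow> y i = y' i"
  shows "W \<Lambda>2 k l (f y) \<subseteq> W \<Lambda>2 k l (f y')"
proof
  fix w assume "w \<in> W \<Lambda>2 k l (f y)"
  then have w: "length w = gap k l" and in2: "fill k w (f y) \<in> \<Lambda>2" by (simp_all add: W_def)
  have len: "k + int (length w) = l - 1" using w kl by (simp add: gap_def)
  define p q where "p = k - 3 * N" and "q = l + 3 * N"
  define t where "t = g (fill k w (f y))"
  have t: "t \<in> \<Lambda>1" "f t = fill k w (f y)" using in2 by (simp_all add: t_def g_in fg)
  have t_out: "t i = y i" if i: "i \<le> k - N \<or> l + N \<le> i" for i
  proof -
    have "t i = g (f y) i"
      unfolding t_def
      by (rule sliding_block_codeD[OF g_code in2 f_in[OF y(1)]])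
        (use i kl len in \<open>auto simp: fill_def\<close>)
    then show ?thesis by (simp add: gf y)
  qed
  define u where "u = map t [p + 1..q - 1]"
  have lu: "length u = gap p q" "p + int (length u) = q - 1"
    using kl N_nonneg by (auto simp: u_def gap_def p_def q_def)
  have u_at: "fill p u r i = (if p < i \<and> i < q then t i else r i)" for r i
    using lu(2) by (auto simp: fill_def u_def)
  have "fill p u y = t"
  proof
    fix i
    show "fill p u y i = t i"
      unfolding u_at using t_out[of i] N_nonneg by (auto simp: p_def q_def)
  qed
  then have "u \<in> W \<Lambda>1 p q y" using t(1) lu by (simp add: W_def)
  then have "u \<in> W \<Lambda>1 p q y'" using W by (simp add: p_def q_def)
  define t' where "t' = fill p u y'"
  have t': "t' \<in> \<Lambda>1" using \<open>u \<in> W \<Lambda>1 p q y'\<close> by (simp add: W_def t'_def)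
  have t'_in: "t' i = t i" if "p < i" "i < q" for i
    using that by (simp add: t'_def u_at)
  have t'_out: "t' i = y' i" if "i \<le> k - N \<or> l + N \<le> i" for i
    unfolding t'_def u_at
    using that t_out[OF that] left[of i] right[of i] N_nonneg by (auto simp: p_def q_def)
  have "f t' = fill k w (f y')"
  proof
    fix i
    \<comment> \<open>At distance at least \<open>2 N\<close> from the gap the code sees \<open>y'\<close>, at smaller distance it sees \<open>t\<close>.\<close>
    consider "i \<le> k - 2 * N \<or> l + 2 * N \<le> i" | "k - 2 * N < i" "i < l + 2 * N" by linarith
    then show "f t' i = fill k w (f y') i"
    proof cases
      case 1
      have "f t' i = f y' i"
        by (rule sliding_block_codeD[OF f_code t' y(2)], rule t'_out) (use 1 in linarith)
      moreover have "\<not> (k < i \<and> i < l)" using 1 N_nonneg by linarith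
      ultimately show ?thesis using len by (auto simp: fill_def)
    next
      case 2
      have ft': "f t' i = fill k w (f y) i"
        unfolding t(2)[symmetric]
        by (rule sliding_block_codeD[OF f_code t' t(1)], rule t'_in) (use 2 in \<open>auto simp: p_def q_def\<close>)
      have "f y i = f y' i" if "\<not> (k < i \<and> i < l)"
      proof (cases "i \<le> k")
        case True
        show ?thesis
          by (rule sliding_block_codeD[OF f_code y], rule left) (use 2 True in linarith)+
      next
        case False
        show ?thesis
          by (rule sliding_block_codeD[OF f_code y], rule right) (use 2 False that in linarith)+
      qed
      then show ?thesis using ft' len by (simp add: fill_def)
    qed
  qed
  then show "w \<in> W \<Lambda>2 k l (f y')" using t' f_in w by (simp add: W_def flip: \<open>f t' = fill k w (f y')\<close>)
qed

lemma cvertex_local: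
  assumes "y \<in> \<Lambda>1" "y' \<in> \<Lambda>1" "k < l"
    and "W \<Lambda>1 (k - 3 * N) (l + 3 * N) y = W \<Lambda>1 (k - 3 * N) (l + 3 * N) y'"
    and "\<And>i. k - 3 * N < i \<Longrightarrow> i \<le> k + N \<Longrightarrow> y i = y' i"
    and "\<And>i. l - N \<le> i \<Longrightarrow> i < l + 3 * N \<Longrightarrow> y i = y' i"
  shows "cvertex \<Lambda>2 k l (f y) = cvertex \<Lambda>2 k l (f y')"
proof -
  have "W \<Lambda>2 k l (f y) = W \<Lambda>2 k l (f y')"
    using central_class_local[OF assms]
      central_class_local[OF assms(2,1,3) assms(4-6)[symmetric]] by blast
  then show ?thesis using assms f_in by (simp add: cvertex_eq_iff[OF sub2])
qed

text \<open>
  By \<open>cvertex_local\<close> the class does not depend on the chosen approximant.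
\<close>

definition lift_vertex :: "('a cvert, 'a cedge, 'a cedge) config \<Rightarrow> int \<Rightarrow> int \<Rightarrow> 'b cvert" where
  "lift_vertex x k l = cvertex \<Lambda>2 k l (f (SOME y. y \<in> approximants \<Lambda>1 x (k - 3 * N) (l + 3 * N)))"

definition lift :: "('a cvert, 'a cedge, 'a cedge) config \<Rightarrow> ('b cvert, 'b cedge, 'b cedge) config" where
  "lift x = assemble (f (factor_map \<Lambda>1 x)) (lift_vertex x)"

lemma lift_vertex_eq:
  assumes "k < l" "y \<in> approximants \<Lambda>1 x (k - 3 * N) (l + 3 * N)"
  shows "lift_vertex x k l = cvertex \<Lambda>2 k l (f y)"
proof -
  let ?r = "SOME y. y \<in> approximants \<Lambda>1 x (k - 3 * N) (l + 3 * N)"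
  have "?r \<in> approximants \<Lambda>1 x (k - 3 * N) (l + 3 * N)"
    using assms(2) by (rule someI[of "\<lambda>y. y \<in> approximants \<Lambda>1 x (k - 3 * N) (l + 3 * N)"])
  then show ?thesis
    unfolding lift_vertex_def using assms N_nonneg
    by (intro cvertex_local) (auto simp: approximants_def cvertex_eq_iff[OF sub1])
qed

lemma f_approximates_labels:
  assumes "x \<in> X_space \<Lambda>1" "y \<in> approximants \<Lambda>1 x (k - 3 * N) (l + 3 * N)" "k < i" "i < l"
  shows "f y i = f (factor_map \<Lambda>1 x) i"
  using assms N_nonneg factor_map_in_subshift[OF sub1 assms(1)]
  by (intro sliding_block_codeD[OF f_code]) (auto simp: approximants_def)

lemma lift_approximated:
  assumes "x \<in> X_space \<Lambda>1" "p < q"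
  shows "\<exists>z\<in>\<Lambda>2. (\<forall>i. p < i \<and> i < q \<longrightarrow> z i = f (factor_map \<Lambda>1 x) i) \<and>
    (\<forall>k l. p \<le> k \<and> k < l \<and> l \<le> q \<longrightarrow> lift_vertex x k l = cvertex \<Lambda>2 k l z)"
proof -
  obtain y where y: "y \<in> approximants \<Lambda>1 x (p - 3 * N) (q + 3 * N)"
    using approximants_nonempty[OF sub1 assms(1), of "p - 3 * N" "q + 3 * N"] assms(2) N_nonneg by fastforce
  have "lift_vertex x k l = cvertex \<Lambda>2 k l (f y)" if "p \<le> k" "k < l" "l \<le> q" for k l
    using that y approximants_mono[OF sub1 assms(1), of "p - 3 * N" "k - 3 * N" "l + 3 * N" "q + 3 * N"] N_nonneg
    by (intro lift_vertex_eq) auto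
  moreover have "f y \<in> \<Lambda>2" using y f_in by (simp add: approximants_def)
  ultimately show ?thesis using f_approximates_labels[OF assms(1) y] by blast
qed

lemma lift_in: "x \<in> X_space \<Lambda>1 \<Longrightarrow> lift x \<in> X_space \<Lambda>2"
  and factor_map_lift: "x \<in> X_space \<Lambda>1 \<Longrightarrow> factor_map \<Lambda>2 (lift x) = f (factor_map \<Lambda>1 x)"
  and vert_lift: "x \<in> X_space \<Lambda>1 \<Longrightarrow> k < l \<Longrightarrow> vert (lift x) k l = lift_vertex x k l"
  unfolding lift_def using assemble_approximated[OF sub2 lift_approximated] by blast+

text \<open>
  The characteristic property of the lift, from which its inverse, its equivariance and its
  continuity are derived.
\<close>

lemma approximants_lift:
  assumes "x \<in> X_space \<Lambda>1" "k < l" "y \<in> approximants \<Lambda>1 x (k - 3 * N) (l + 3 * N)"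
  shows "f y \<in> approximants \<Lambda>2 (lift x) k l"
  using assms f_in f_approximates_labels[OF assms(1,3)]
  by (auto simp: approximants_def factor_map_lift vert_lift lift_vertex_eq[OF assms(2,3)])

text \<open>
  If \<open>y\<close> approximates \<open>x\<close> on a window that is \<open>6 N\<close> larger on either side, then \<open>g (f y)\<close>, which is
  \<open>y\<close> again, approximates the image of \<open>x\<close> under both lifts.
\<close>

lemma lift_inverse:
  assumes "x \<in> X_space \<Lambda>1"
  shows "coded_conjugacy.lift \<Lambda>2 \<Lambda>1 g N (lift x) = x"
proof -
  interpret inv: coded_conjugacy S2 \<Lambda>2 S1 \<Lambda>1 g f N by (rule inverse_conjugacy)
  show ?thesis
  proof (rule X_space_eq_by_approximants[OF inv.lift_in[OF lift_in[OF assms]] assms])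
    fix k l :: int assume kl: "k < l"
    obtain y where y: "y \<in> approximants \<Lambda>1 x (k - 3 * N - 3 * N) (l + 3 * N + 3 * N)"
      using approximants_nonempty[OF sub1 assms, of "k - 3 * N - 3 * N" "l + 3 * N + 3 * N"] kl N_nonneg by fastforce
    then have "f y \<in> approximants \<Lambda>2 (lift x) (k - 3 * N) (l + 3 * N)"
      using kl N_nonneg by (intro approximants_lift[OF assms]) auto
    then have "g (f y) \<in> approximants \<Lambda>1 (inv.lift (lift x)) k l"
      by (rule inv.approximants_lift[OF lift_in[OF assms] kl])
    moreover have "g (f y) = y" using y by (simp add: approximants_def gf)
    moreover have "y \<in> approximants \<Lambda>1 x k l"
      using y approximants_mono[OF sub1 assms, of "k - 3 * N - 3 * N" k l "l + 3 * N + 3 * N"] kl N_nonneg by auto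
    ultimately show "approximants \<Lambda>1 (inv.lift (lift x)) k l \<inter> approximants \<Lambda>1 x k l \<noteq> {}" by auto
  qed
qed

lemma lift_shift:
  assumes "x \<in> X_space \<Lambda>1"
  shows "lift (config_shift x) = config_shift (lift x)"
proof (rule X_space_eq_by_approximants)
  show "lift (config_shift x) \<in> X_space \<Lambda>2" "config_shift (lift x) \<in> X_space \<Lambda>2"
    using assms by (simp_all add: lift_in config_shift_X_space)
  fix k l :: int assume kl: "k < l"
  obtain y where y: "y \<in> approximants \<Lambda>1 x (k + 1 - 3 * N) (l + 1 + 3 * N)"
    using approximants_nonempty[OF sub1 assms, of "k + 1 - 3 * N" "l + 1 + 3 * N"] kl N_nonneg by fastforce
  then have "shift (f y) \<in> approximants \<Lambda>2 (config_shift (lift x)) k l"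
    using kl assms by (intro approximants_shift[OF sub2] approximants_lift lift_in) auto
  moreover have "f (shift y) \<in> approximants \<Lambda>2 (lift (config_shift x)) k l"
  proof (rule approximants_lift[OF config_shift_X_space(1)[OF assms] kl])
    show "shift y \<in> approximants \<Lambda>1 (config_shift x) (k - 3 * N) (l + 3 * N)"
      using y kl N_nonneg by (intro approximants_shift[OF sub1 assms]) (auto simp: algebra_simps)
  qed
  moreover have "f (shift y) = shift (f y)" using y by (simp add: approximants_def f_shift)
  ultimately show "approximants \<Lambda>2 (lift (config_shift x)) k l \<inter> approximants \<Lambda>2 (config_shift (lift x)) k l \<noteq> {}"
    by auto
qed

text \<open>
  Configurations in a common cylinder at \<open>(p - 3 N, q + 3 N)\<close> share an approximant, so their lifts
  share one at \<open>(p, q)\<close> and lie in the same cylinder there.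
\<close>

lemma continuous_map_lift: "continuous_map (X_topology \<Lambda>1) (X_topology \<Lambda>2) lift"
  unfolding config_topology_def[of "canonical_bisystem \<Lambda>2"]
proof (rule continuous_on_generated_topo)
  let ?G = "{cyl (canonical_bisystem \<Lambda>2) p q \<mu> v | p q \<mu> v. p < q \<and>
    v \<in> V (canonical_bisystem \<Lambda>2) (gap p q) \<and> \<mu> \<in> P_words (canonical_bisystem \<Lambda>2) (gap p q) v}"
  show "lift ` topspace (X_topology \<Lambda>1) \<subseteq> \<Union>?G"
    using lift_in topspace_config_topology[of "canonical_bisystem \<Lambda>2"]
    by (auto simp: topspace_config_topology[of "canonical_bisystem \<Lambda>1"]
        config_topology_def[of "canonical_bisystem \<Lambda>2"])
  fix U assume "U \<in> ?G"
  then obtain p q \<mu> v where U: "U = cyl (canonical_bisystem \<Lambda>2) p q \<mu> v" "p < q" by blast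
  show "openin (X_topology \<Lambda>1) (lift -` U \<inter> topspace (X_topology \<Lambda>1))"
  proof (subst openin_subopen, intro ballI)
    fix x assume "x \<in> lift -` U \<inter> topspace (X_topology \<Lambda>1)"
    then have x: "x \<in> X_space \<Lambda>1" "lift x \<in> U" by (auto simp: topspace_config_topology)
    let ?p = "p - 3 * N" and ?q = "q + 3 * N"
    let ?C = "{z \<in> X_space \<Lambda>1. vert z ?p ?q = vert x ?p ?q \<and>
      (\<forall>i. ?p < i \<and> i < ?q \<longrightarrow> factor_map \<Lambda>1 z i = factor_map \<Lambda>1 x i)}"
    have pq: "?p < ?q" using U(2) N_nonneg by simp
    obtain y where y: "y \<in> approximants \<Lambda>1 x ?p ?q" using approximants_nonempty[OF sub1 x(1) pq] by blast
    have "lift z \<in> U" if z: "z \<in> ?C" for z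
    proof -
      have "y \<in> approximants \<Lambda>1 z ?p ?q" using y z by (auto simp: approximants_def)
      then have "f y \<in> approximants \<Lambda>2 (lift z) p q" "f y \<in> approximants \<Lambda>2 (lift x) p q"
        using approximants_lift U(2) x(1) y z by auto
      then have "vert (lift z) p q = vert (lift x) p q"
        "map (factor_map \<Lambda>2 (lift z)) [p + 1..q - 1] = map (factor_map \<Lambda>2 (lift x)) [p + 1..q - 1]"
        by (auto simp: approximants_def)
      moreover have "vert (lift x) p q = v" "map (factor_map \<Lambda>2 (lift x)) [p + 1..q - 1] = \<mu>"
        using x(2) by (simp_all add: U(1) cyl_def)
      moreover have "lift z \<in> X_space \<Lambda>2" using z lift_in by blast
      ultimately show ?thesis unfolding U(1) cyl_def mem_Collect_eq by metis
    qed
    then show "\<exists>T. openin (X_topology \<Lambda>1) T \<and> x \<in> T \<and> T \<subseteq> lift -` U \<inter> topspace (X_topology \<Lambda>1)"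
      using openin_config_cylinder[OF x(1) pq] x(1)
      by (intro exI[of _ ?C]) (auto simp: topspace_config_topology)
  qed
qed

text \<open>
  The approximants of two equivalent configurations agree only outside of the gap from \<open>p\<close> to \<open>q\<close>.
  For \<open>k \<le> p - 3 N\<close> and \<open>q + 3 N \<le> l\<close> this covers all letters that \<open>cvertex_local\<close> compares.
\<close>

lemma lift_R_level:
  assumes "p < q"
  shows "map_prod lift lift ` R_level (canonical_bisystem \<Lambda>1) p q \<subseteq>
    R_level (canonical_bisystem \<Lambda>2) (p - 3 * N) (q + 3 * N)"
proof -
  have "(lift x, lift z) \<in> R_level (canonical_bisystem \<Lambda>2) (p - 3 * N) (q + 3 * N)"
    if "(x, z) \<in> R_level (canonical_bisystem \<Lambda>1) p q" for x z
  proof -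
    from that have x: "x \<in> X_space \<Lambda>1" and z: "z \<in> X_space \<Lambda>1"
      and vert: "\<And>k l. k \<le> p \<Longrightarrow> q \<le> l \<Longrightarrow> vert x k l = vert z k l"
      and label: "\<And>i. i \<le> p \<or> q \<le> i \<Longrightarrow> factor_map \<Lambda>1 x i = factor_map \<Lambda>1 z i"
      by (auto simp: R_level_canonical_iff[OF assms])
    have "vert (lift x) k l = vert (lift z) k l" if kl: "k \<le> p - 3 * N" "q + 3 * N \<le> l" for k l
    proof -
      have k: "k < l" "k - 3 * N < l + 3 * N" using kl assms N_nonneg by auto
      obtain y y' where y: "y \<in> approximants \<Lambda>1 x (k - 3 * N) (l + 3 * N)"
        "y' \<in> approximants \<Lambda>1 z (k - 3 * N) (l + 3 * N)"
        using approximants_nonempty[OF sub1 x k(2)] approximants_nonempty[OF sub1 z k(2)] by blast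
      have yi: "y i = y' i" if "k - 3 * N < i" "i < l + 3 * N" "i \<le> p \<or> q \<le> i" for i
        using y that label[of i] by (simp add: approximants_def)
      have "cvertex \<Lambda>2 k l (f y) = cvertex \<Lambda>2 k l (f y')"
      proof (rule cvertex_local)
        show "W \<Lambda>1 (k - 3 * N) (l + 3 * N) y = W \<Lambda>1 (k - 3 * N) (l + 3 * N) y'"
        proof -
          have "vert x (k - 3 * N) (l + 3 * N) = vert z (k - 3 * N) (l + 3 * N)"
            using kl assms N_nonneg by (intro vert) auto
          then have "y \<in> \<Lambda>1" "y' \<in> \<Lambda>1"
            "cvertex \<Lambda>1 (k - 3 * N) (l + 3 * N) y = cvertex \<Lambda>1 (k - 3 * N) (l + 3 * N) y'"
            using y by (auto simp: approximants_def)
          then show ?thesis using k(2) by (simp add: cvertex_eq_iff[OF sub1])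
        qed
      qed (use y k kl assms N_nonneg yi in \<open>auto simp: approximants_def\<close>)
      then show ?thesis
        using y k by (simp add: vert_lift x z lift_vertex_eq)
    qed
    moreover have "f (factor_map \<Lambda>1 x) i = f (factor_map \<Lambda>1 z) i" if "i \<le> p - 3 * N \<or> q + 3 * N \<le> i" for i
      by (rule sliding_block_codeD[OF f_code factor_map_in_subshift[OF sub1 x] factor_map_in_subshift[OF sub1 z]])
        (use that N_nonneg in \<open>auto intro!: label\<close>)
    ultimately show ?thesis
      using assms N_nonneg by (simp add: R_level_canonical_iff x z lift_in factor_map_lift)
  qed
  then show ?thesis by auto
qed

lemma lift_R_rel: "map_prod lift lift ` RL_rel \<Lambda>1 \<subseteq> RL_rel \<Lambda>2"
  and continuous_map_lift_R: "continuous_map (RL_topology \<Lambda>1) (RL_topology \<Lambda>2) (map_prod lift lift)"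
proof -
  show cont: "continuous_map (RL_topology \<Lambda>1) (RL_topology \<Lambda>2) (map_prod lift lift)"
  proof (rule continuous_map_R_topology[OF continuous_map_lift])
    fix p q :: int assume pq: "p < q"
    then have "p - 3 * N < q + 3 * N" using N_nonneg by simp
    then show "\<exists>p' q'. p' < q' \<and> map_prod lift lift ` R_level (canonical_bisystem \<Lambda>1) p q \<subseteq>
        R_level (canonical_bisystem \<Lambda>2) p' q'"
      using lift_R_level[OF pq] by blast
  qed
  show "map_prod lift lift ` RL_rel \<Lambda>1 \<subseteq> RL_rel \<Lambda>2"
    using continuous_map_image_subset_topspace[OF cont] by (simp add: topspace_R_topology)
qed

theorem lift_conjugacy:
  "homeomorphic_map (X_topology \<Lambda>1) (X_topology \<Lambda>2) lift"
  "map_prod lift lift ` RL_rel \<Lambda>1 = RL_rel \<Lambda>2"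
  "homeomorphic_map (RL_topology \<Lambda>1) (RL_topology \<Lambda>2) (map_prod lift lift)"
proof -
  interpret inv: coded_conjugacy S2 \<Lambda>2 S1 \<Lambda>1 g f N by (rule inverse_conjugacy)
  have R: "RL_rel \<Lambda>1 \<subseteq> X_space \<Lambda>1 \<times> X_space \<Lambda>1" "RL_rel \<Lambda>2 \<subseteq> X_space \<Lambda>2 \<times> X_space \<Lambda>2"
    by (auto simp: R_rel_def R_level_def)
  have 1: "map_prod inv.lift inv.lift (map_prod lift lift r) = r" if "r \<in> RL_rel \<Lambda>1" for r
    using that R(1) lift_inverse by (cases r) auto
  have 2: "map_prod lift lift (map_prod inv.lift inv.lift r) = r" if "r \<in> RL_rel \<Lambda>2" for r
    using that R(2) inv.lift_inverse by (cases r) auto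
  show "homeomorphic_map (X_topology \<Lambda>1) (X_topology \<Lambda>2) lift"
    unfolding homeomorphic_map_maps homeomorphic_maps_def topspace_config_topology
    using continuous_map_lift inv.continuous_map_lift lift_inverse inv.lift_inverse by blast
  show "homeomorphic_map (RL_topology \<Lambda>1) (RL_topology \<Lambda>2) (map_prod lift lift)"
    unfolding homeomorphic_map_maps homeomorphic_maps_def topspace_R_topology
    using continuous_map_lift_R inv.continuous_map_lift_R 1 2 by blast
  show "map_prod lift lift ` RL_rel \<Lambda>1 = RL_rel \<Lambda>2"
  proof
    show "RL_rel \<Lambda>2 \<subseteq> map_prod lift lift ` RL_rel \<Lambda>1"
    proof
      fix r assume r: "r \<in> RL_rel \<Lambda>2"
      then have "map_prod inv.lift inv.lift r \<in> RL_rel \<Lambda>1" using inv.lift_R_rel by blast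
      then show "r \<in> map_prod lift lift ` RL_rel \<Lambda>1" by (rule rev_image_eqI) (simp only: 2[OF r])
    qed
  qed (rule lift_R_rel)
qed

end

text \<open>
  The larger of the two radii provided by the Curtis--Hedlund--Lyndon theorem serves both \<open>f\<close> and
  its inverse.
\<close>

lemma conjugate_via_coded:
  assumes "subshift S1 \<Lambda>1" "subshift S2 \<Lambda>2" "conjugate_via S1 \<Lambda>1 S2 \<Lambda>2 f"
  obtains g N where "coded_conjugacy S1 \<Lambda>1 S2 \<Lambda>2 f g N"
proof -
  have f_shift: "\<And>y. y \<in> \<Lambda>1 \<Longrightarrow> f (shift y) = shift (f y)"
    using assms(3) by (simp add: conjugate_via_def)
  obtain g where g: "homeomorphic_maps (subshift_topology S1 \<Lambda>1) (subshift_topology S2 \<Lambda>2) f g"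
    using assms(3) unfolding conjugate_via_def homeomorphic_map_maps by blast
  have cf: "continuous_map (subshift_topology S1 \<Lambda>1) (full_shift_topology S2) f"
    and cg: "continuous_map (subshift_topology S2 \<Lambda>2) (full_shift_topology S1) g"
    using g by (auto simp: homeomorphic_maps_def subshift_topology_def[of S2] subshift_topology_def[of S1]
        dest: continuous_map_into_fulltopology)
  have f_in: "f y \<in> \<Lambda>2" and gf: "g (f y) = y" if "y \<in> \<Lambda>1" for y
    using g that unfolding homeomorphic_maps_def continuous_map_def
      topspace_subshift[OF assms(1)] topspace_subshift[OF assms(2)] by auto
  have g_in: "g z \<in> \<Lambda>1" and fg: "f (g z) = z" if "z \<in> \<Lambda>2" for z
    using g that unfolding homeomorphic_maps_def continuous_map_def
      topspace_subshift[OF assms(1)] topspace_subshift[OF assms(2)] by auto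
  have g_shift: "g (shift z) = shift (g z)" if z: "z \<in> \<Lambda>2" for z
  proof -
    have "shift (g z) \<in> \<Lambda>1" using g_in[OF z] by (simp add: shift_by_in_subshift[OF assms(1)])
    then have "shift (g z) = g (f (shift (g z)))" by (simp add: gf)
    also have "\<dots> = g (shift z)" using z by (simp add: f_shift g_in fg)
    finally show ?thesis by simp
  qed
  obtain m n where mn: "0 \<le> m" "sliding_block_code m \<Lambda>1 f" "0 \<le> n" "sliding_block_code n \<Lambda>2 g"
    using curtis_hedlund_lyndon[OF assms(1) cf f_shift] curtis_hedlund_lyndon[OF assms(2) cg g_shift] by metis
  have "coded_conjugacy S1 \<Lambda>1 S2 \<Lambda>2 f g (max m n)"
    using assms f_in gf g_in fg f_shift mn
      sliding_block_code_mono[OF mn(2), of "max m n"] sliding_block_code_mono[OF mn(4), of "max m n"]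
    by unfold_locales auto
  then show ?thesis by (rule that)
qed

theorem proposition7p3:
  fixes S1 :: "'a set" and \<Lambda>1 :: "(int \<Rightarrow> 'a) set"
    and S2 :: "'b set" and \<Lambda>2 :: "(int \<Rightarrow> 'b) set"
    and h\<Lambda> :: "(int \<Rightarrow> 'a) \<Rightarrow> (int \<Rightarrow> 'b)"
  assumes "subshift S1 \<Lambda>1" and "subshift S2 \<Lambda>2"
    and "conjugate_via S1 \<Lambda>1 S2 \<Lambda>2 h\<Lambda>"
  shows "\<exists>h. homeomorphic_map (X_topology \<Lambda>1) (X_topology \<Lambda>2) h \<and>
           (\<forall>x \<in> X_space \<Lambda>1. h\<Lambda> (factor_map \<Lambda>1 x) = factor_map \<Lambda>2 (h x)) \<and>
           (\<forall>x \<in> X_space \<Lambda>1. h (config_shift x) = config_shift (h x)) \<and>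
           map_prod h h ` RL_rel \<Lambda>1 = RL_rel \<Lambda>2 \<and>
           homeomorphic_map (RL_topology \<Lambda>1) (RL_topology \<Lambda>2) (map_prod h h)"
proof -
  obtain g N where "coded_conjugacy S1 \<Lambda>1 S2 \<Lambda>2 h\<Lambda> g N"
    using conjugate_via_coded[OF assms] .
  then interpret coded_conjugacy S1 \<Lambda>1 S2 \<Lambda>2 h\<Lambda> g N .
  show ?thesis
    using lift_conjugacy by (intro exI[of _ lift]) (simp add: factor_map_lift lift_shift)
qed

end
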